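(* Let $F : [0,\infty) \to \mathbb{R}$ and let $d$ be a positive integer. The following are equivalent. (1) $F$ preserves total non-negativity entrywise on symmetric $d \times d$ matrices. (2) $F$ is either a non-negative constant or: (a) if $d = 1$: $F(x) \geq 0$ for all $x \geq 0$; (b) if $d = 2$: $F$ is non-negative, non-decreasing, and multiplicatively mid-convex, that is, $F(\sqrt{xy})^2 \leq F(x)F(y)$ for all $x, y \in [0,\infty)$ (so $F$ is continuous on $(0,\infty)$); (c) if $d = 3$: $F(x) = c x^\alpha$ for some $c > 0$ and some $\alpha \geq 1$; (d) if $d = 4$: $F(x) = c x^\alpha$ for some $c > 0$ and some $\alpha \in \{1\} \cup [2,\infty)$; (e) if $d \geq 5$: $F(x) = cx$ for some $c > 0$. The same characterizations hold for the functions $F$ such that $F \circ K$ is totally non-negative for every symmetric totally non-negative kernel $K : X \times X \to \mathbb{R}$, where $X$ is a totally ordered set of size $d$, which may now be infinite (an infinite $X$ falling under case (e)).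
   Context: A real matrix is totally non-negative if all of its minors (of every size) are non-negative. For a matrix $A = (a_{ij})$ with entries in $[0,\infty)$, $F[A] := (F(a_{ij}))$. "$F$ preserves total non-negativity entrywise on symmetric $d \times d$ matrices" means that $F[A]$ is totally non-negative whenever $A$ is a symmetric totally non-negative $d \times d$ matrix. A kernel $K : X \times X \to \mathbb{R}$ on a totally ordered set $X$ is totally non-negative if $\det(K(x_i,y_j))_{i,j=1}^n \geq 0$ for all $n \in \mathbb{N}$ and all $x_1 < \cdots < x_n$, $y_1 < \cdots < y_n$ in $X$; it is symmetric if $K(x,y) = K(y,x)$. *)

theory Defs
  imports
    "HOL-Analysis.Analysis"
    "Jordan_Normal_Form.Determinant"
    "Jordan_Normal_Form.DL_Submatrix"
begin

(* HOL-Analysis also has a det (for matrices indexed by finite types); here det is that of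
   Jordan_Normal_Form, whose matrices carry their dimensions as values. *)
hide_const (open) Determinants.det

definition tn_mat :: "real mat \<Rightarrow> bool" where
  "tn_mat A \<longleftrightarrow>
     (\<forall>I J. I \<subseteq> {..<dim_row A} \<longrightarrow> J \<subseteq> {..<dim_col A} \<longrightarrow> card I = card J \<longrightarrow>
        det (submatrix A I J) \<ge> 0)"

(* Functions on [0,\<infinity>) are represented by functions on the reals, of which only the values on
   [0,\<infinity>) are ever used: the entries of a totally non-negative matrix (kernel) are 1-by-1 minors,
   hence non-negative. *)
definition preserves_tn_sym_mat :: "nat \<Rightarrow> (real \<Rightarrow> real) \<Rightarrow> bool" where
  "preserves_tn_sym_mat d F \<longleftrightarrow>
     (\<forall>A \<in> carrier_mat d d. transpose_mat A = A \<longrightarrow> tn_mat A \<longrightarrow> tn_mat (map_mat F A))"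

(* A kernel on X is a function of two variables restricted to X; x and y enumerate
   x_0 < ... < x_(n-1) and y_0 < ... < y_(n-1) in X. *)
definition tn_kernel_on :: "'a::linorder set \<Rightarrow> ('a \<Rightarrow> 'a \<Rightarrow> real) \<Rightarrow> bool" where
  "tn_kernel_on X K \<longleftrightarrow>
     (\<forall>(n::nat) x y.
        strict_mono_on {..<n} x \<longrightarrow> x ` {..<n} \<subseteq> X \<longrightarrow>
        strict_mono_on {..<n} y \<longrightarrow> y ` {..<n} \<subseteq> X \<longrightarrow>
        det (mat n n (\<lambda>(i, j). K (x i) (y j))) \<ge> 0)"

definition sym_kernel_on :: "'a set \<Rightarrow> ('a \<Rightarrow> 'a \<Rightarrow> real) \<Rightarrow> bool" where
  "sym_kernel_on X K \<longleftrightarrow> (\<forall>x\<in>X. \<forall>y\<in>X. K x y = K y x)"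

definition preserves_tn_sym_kernel :: "'a::linorder set \<Rightarrow> (real \<Rightarrow> real) \<Rightarrow> bool" where
  "preserves_tn_sym_kernel X F \<longleftrightarrow>
     (\<forall>K. sym_kernel_on X K \<longrightarrow> tn_kernel_on X K \<longrightarrow> tn_kernel_on X (\<lambda>x y. F (K x y)))"

definition nonneg_constant :: "(real \<Rightarrow> real) \<Rightarrow> bool" where
  "nonneg_constant F \<longleftrightarrow> (\<exists>c\<ge>0. \<forall>x\<ge>0. F x = c)"

definition mult_mid_convex :: "(real \<Rightarrow> real) \<Rightarrow> bool" where
  "mult_mid_convex F \<longleftrightarrow> (\<forall>x\<ge>0. \<forall>y\<ge>0. (F (sqrt (x * y)))\<^sup>2 \<le> F x * F y)"

definition case_a :: "(real \<Rightarrow> real) \<Rightarrow> bool" where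
  "case_a F \<longleftrightarrow> (\<forall>x\<ge>0. F x \<ge> 0)"

definition case_b :: "(real \<Rightarrow> real) \<Rightarrow> bool" where
  "case_b F \<longleftrightarrow> (\<forall>x\<ge>0. F x \<ge> 0) \<and> mono_on {0..} F \<and> mult_mid_convex F"

(* powr gives 0 powr \<alpha> = 0, as required for \<alpha> > 0. *)
definition case_c :: "(real \<Rightarrow> real) \<Rightarrow> bool" where
  "case_c F \<longleftrightarrow> (\<exists>c>0. \<exists>\<alpha>\<ge>1. \<forall>x\<ge>0. F x = c * x powr \<alpha>)"

definition case_d :: "(real \<Rightarrow> real) \<Rightarrow> bool" where
  "case_d F \<longleftrightarrow> (\<exists>c>0. \<exists>\<alpha>\<in>{1} \<union> {2..}. \<forall>x\<ge>0. F x = c * x powr \<alpha>)"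

definition case_e :: "(real \<Rightarrow> real) \<Rightarrow> bool" where
  "case_e F \<longleftrightarrow> (\<exists>c>0. \<forall>x\<ge>0. F x = c * x)"

definition tn_characterization :: "nat \<Rightarrow> (real \<Rightarrow> real) \<Rightarrow> bool" where
  "tn_characterization d F \<longleftrightarrow>
     nonneg_constant F \<or>
     (d = 1 \<and> case_a F) \<or>
     (d = 2 \<and> case_b F) \<or>
     (d = 3 \<and> case_c F) \<or>
     (d = 4 \<and> case_d F) \<or>
     (d \<ge> 5 \<and> case_e F)"

end

(* Necessity. All test kernels are Gram kernels i, j |-> p_i . p_j of points p_i in R^3 that form the
   rows of a totally non-negative matrix with three columns. Rank one kernels of size 3 force
   F(x) F(y) = F(t) F(xy/t), hence a power law x^alpha on the positive reals, and the points
   (1,0), (1,1), (0,1) leave alpha = 0 (a constant) or alpha >= 1.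
   For 1 < alpha < 2, the points (1,0), (1,x), (1,1/x), (0,1) with x -> 0 give a negative determinant.
   For size 5, the minor with rows 1-4 and columns 0, 1, 2, 4 of the Gram kernel of (L,1,0),
   (2e/L,1,0), (e/L,1,s), (0,1,2s), (0,1,3s) vanishes identically when alpha = 1; letting L -> infinity,
   then e -> 0, then s -> 0, its leading coefficient is a negative multiple of
   alpha (alpha - 1) for every alpha > 1.

   Sufficiency. For alpha >= 1 the 3-by-3 minors are handled by multiplying with the central entry,
   which turns the determinant into a difference of two products of 2-by-2 minors, and Bernoulli's
   inequality. For size 4 and alpha >= 2 only the full determinant of a symmetric matrix is left; it
   is non-negative by the theorem of FitzGerald and Horn on entrywise powers of positive semidefinite
   matrices. *)
theory Submission
  imports "HOL-Real_Asymp.Real_Asymp" Defs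
begin

section \<open>Determinants and totally non-negative kernels\<close>

lemma det_mat_0 [simp]: "det (mat 0 0 f) = (1::real)"
  by (rule det_dim_zero) auto

text \<open>Laplace expansion along row 0. The deleted column is skipped by reindexing, so every
  minor is again of the form \<open>mat n n\<close> and the rule can be iterated to closed formulas
  for small sizes.\<close>

lemma det_mat_Suc:
  fixes f :: "nat \<times> nat \<Rightarrow> real"
  shows "det (mat (Suc n) (Suc n) f) =
    (\<Sum>j<Suc n. (-1) ^ j * f (0, j) *
       det (mat n n (\<lambda>(i, k). f (Suc i, if k < j then k else Suc k))))"
proof -
  have "det (mat (Suc n) (Suc n) f) =
      (\<Sum>j<Suc n. mat (Suc n) (Suc n) f $$ (0, j) * cofactor (mat (Suc n) (Suc n) f) 0 j)"
    by (rule laplace_expansion_row) auto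
  also have "\<dots> = (\<Sum>j<Suc n. (-1) ^ j * f (0, j) *
       det (mat n n (\<lambda>(i, k). f (Suc i, if k < j then k else Suc k))))"
  proof (rule sum.cong[OF refl])
    fix j assume "j \<in> {..<Suc n}"
    moreover have "mat_delete (mat (Suc n) (Suc n) f) 0 j =
        mat n n (\<lambda>(i, k). f (Suc i, if k < j then k else Suc k))"
      by (rule eq_matI) (auto simp: mat_delete_def)
    ultimately show "mat (Suc n) (Suc n) f $$ (0, j) * cofactor (mat (Suc n) (Suc n) f) 0 j =
       (-1) ^ j * f (0, j) * det (mat n n (\<lambda>(i, k). f (Suc i, if k < j then k else Suc k)))"
      by (simp add: cofactor_def)
  qed
  finally show ?thesis .
qed

lemma det_mat_1: "det (mat (Suc 0) (Suc 0) f) = (f (0, 0) :: real)"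
  by (simp add: det_mat_Suc)

lemma det_mat_2: "det (mat 2 2 f) = (f (0, 0) * f (1, 1) - f (0, 1) * f (1, 0) :: real)"
  by (simp add: det_mat_Suc numeral_2_eq_2)

lemma det_mat_3:
  "det (mat 3 3 f) =
    (f (0, 0) * (f (1, 1) * f (2, 2) - f (1, 2) * f (2, 1))
     - f (0, 1) * (f (1, 0) * f (2, 2) - f (1, 2) * f (2, 0))
     + f (0, 2) * (f (1, 0) * f (2, 1) - f (1, 1) * f (2, 0)) :: real)"
  by (simp add: det_mat_Suc numeral_2_eq_2 numeral_3_eq_3)

lemma det_mat_4:
  "det (mat 4 4 f) =
    (f (0, 0) * (f (1, 1) * (f (2, 2) * f (3, 3) - f (2, 3) * f (3, 2))
      - f (1, 2) * (f (2, 1) * f (3, 3) - f (2, 3) * f (3, 1))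
      + f (1, 3) * (f (2, 1) * f (3, 2) - f (2, 2) * f (3, 1)))
     - f (0, 1) * (f (1, 0) * (f (2, 2) * f (3, 3) - f (2, 3) * f (3, 2))
      - f (1, 2) * (f (2, 0) * f (3, 3) - f (2, 3) * f (3, 0))
      + f (1, 3) * (f (2, 0) * f (3, 2) - f (2, 2) * f (3, 0)))
     + f (0, 2) * (f (1, 0) * (f (2, 1) * f (3, 3) - f (2, 3) * f (3, 1))
      - f (1, 1) * (f (2, 0) * f (3, 3) - f (2, 3) * f (3, 0))
      + f (1, 3) * (f (2, 0) * f (3, 1) - f (2, 1) * f (3, 0)))
     - f (0, 3) * (f (1, 0) * (f (2, 1) * f (3, 2) - f (2, 2) * f (3, 1))
      - f (1, 1) * (f (2, 0) * f (3, 2) - f (2, 2) * f (3, 0))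
      + f (1, 2) * (f (2, 0) * f (3, 1) - f (2, 1) * f (3, 0))) :: real)"
proof -
  have "4 = Suc 3" by simp
  then have "det (mat 4 4 f) = (\<Sum>j<Suc 3. (-1) ^ j * f (0, j) *
       det (mat 3 3 (\<lambda>(i, k). f (Suc i, if k < j then k else Suc k))))"
    by (simp only: det_mat_Suc)
  also have "{..<Suc 3} = {0, 1, 2, 3 :: nat}" by auto
  finally show ?thesis
    unfolding det_mat_3 by (simp add: numeral_2_eq_2 numeral_3_eq_3)
qed

lemma det_zero_row:
  assumes "i < n" "\<And>j. j < n \<Longrightarrow> f (i, j) = 0"
  shows "det (mat n n f) = (0::real)"
  using assms by (subst laplace_expansion_row[of _ n i]) auto

lemma det_zero_col:
  assumes "j < n" "\<And>i. i < n \<Longrightarrow> f (i, j) = 0"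
  shows "det (mat n n f) = (0::real)"
  using assms by (subst laplace_expansion_column[of _ n j]) auto

section \<open>Small minors and Gram kernels\<close>

lemma tn_kernel_onD:
  assumes "tn_kernel_on X K" "strict_mono_on {..<n} x" "x ` {..<n} \<subseteq> X"
    "strict_mono_on {..<n} y" "y ` {..<n} \<subseteq> X"
  shows "det (mat n n (\<lambda>(i, j). K (x i) (y j))) \<ge> 0"
  using assms unfolding tn_kernel_on_def by blast

lemma tn_kernel_on_subset: "tn_kernel_on Y K \<Longrightarrow> X \<subseteq> Y \<Longrightarrow> tn_kernel_on X K"
  unfolding tn_kernel_on_def by (meson order_trans)

lemma det_kernel_cong:
  assumes "\<And>x y. x \<in> X \<Longrightarrow> y \<in> X \<Longrightarrow> K x y = K' x y"
    "x ` {..<n} \<subseteq> X" "y ` {..<n} \<subseteq> X"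
  shows "det (mat n n (\<lambda>(i, j). K (x i) (y j))) = det (mat n n (\<lambda>(i, j). K' (x i) (y j)))"
proof -
  have "mat n n (\<lambda>(i, j). K (x i) (y j)) = mat n n (\<lambda>(i, j). K' (x i) (y j))"
    using assms(2,3) by (intro eq_matI) (simp_all add: image_subset_iff assms(1))
  then show ?thesis by simp
qed

lemma tn_kernel_on_cong:
  assumes "\<And>x y. x \<in> X \<Longrightarrow> y \<in> X \<Longrightarrow> K x y = K' x y"
  shows "tn_kernel_on X K \<longleftrightarrow> tn_kernel_on X K'"
  using det_kernel_cong[of X K K', OF assms] unfolding tn_kernel_on_def by metis

lemma tn_kernel_on_nonneg:
  assumes "tn_kernel_on X K" "x \<in> X" "y \<in> X"
  shows "K x y \<ge> 0"
proof -
  have "strict_mono_on {..<Suc 0} (\<lambda>_. z)" for z :: 'a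
    by (rule strict_mono_onI) simp
  then show ?thesis
    using tn_kernel_onD[OF assms(1), of "Suc 0" "\<lambda>_. x" "\<lambda>_. y"] assms(2,3)
    by (simp add: det_mat_1 image_subset_iff)
qed

lemma tn_kernel_on_minor2:
  assumes "tn_kernel_on X K" "{a, b, c, d} \<subseteq> X" "a < b" "c < d"
  shows "K a c * K b d - K a d * K b c \<ge> 0"
proof -
  let ?x = "\<lambda>i::nat. if i = 0 then a else b" and ?y = "\<lambda>i::nat. if i = 0 then c else d"
  have "strict_mono_on {..<2} ?x" "strict_mono_on {..<2} ?y"
    using assms by (auto simp: strict_mono_on_def)
  then show ?thesis
    using tn_kernel_onD[OF assms(1), of 2 ?x ?y] assms(2) by (auto simp: det_mat_2)
qed

lemma det_scaled_kernel:
  "det (mat n n (\<lambda>(i, j). c * K (x i) (y j))) = c ^ n * det (mat n n (\<lambda>(i, j). K (x i) (y j) :: real))"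
proof -
  have "mat n n (\<lambda>(i, j). c * K (x i) (y j)) = c \<cdot>\<^sub>m mat n n (\<lambda>(i, j). K (x i) (y j))"
    by (rule eq_matI) auto
  then show ?thesis by simp
qed

lemma tn_kernel_on_scale:
  assumes "tn_kernel_on X K" "c \<ge> 0"
  shows "tn_kernel_on X (\<lambda>x y. c * K x y)"
  using assms unfolding tn_kernel_on_def det_scaled_kernel by simp

text \<open>The case of Cauchy--Binet for a Gram kernel of rank at most three: the minors of size at least
  three factor after padding both factors with zero columns.\<close>

lemma tn_kernel_on_gram:
  fixes a b c :: "'a::linorder \<Rightarrow> real"
  assumes nonneg: "\<And>i. i \<in> X \<Longrightarrow> a i \<ge> 0 \<and> b i \<ge> 0 \<and> c i \<ge> 0"
    and minor2: "\<And>i j. i \<in> X \<Longrightarrow> j \<in> X \<Longrightarrow> i < j \<Longrightarrow>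
      a i * b j - b i * a j \<ge> 0 \<and> a i * c j - c i * a j \<ge> 0 \<and> b i * c j - c i * b j \<ge> 0"
    and minor3: "\<And>i j k. i \<in> X \<Longrightarrow> j \<in> X \<Longrightarrow> k \<in> X \<Longrightarrow> i < j \<Longrightarrow> j < k \<Longrightarrow>
      a i * (b j * c k - c j * b k) - b i * (a j * c k - c j * a k)
        + c i * (a j * b k - b j * a k) \<ge> 0"
  shows "tn_kernel_on X (\<lambda>i j. a i * a j + b i * b j + c i * c j)"
  unfolding tn_kernel_on_def
proof (intro allI impI)
  fix n :: nat and x y :: "nat \<Rightarrow> 'a"
  assume xy: "strict_mono_on {..<n} x" "x ` {..<n} \<subseteq> X" "strict_mono_on {..<n} y" "y ` {..<n} \<subseteq> X"
  let ?K = "\<lambda>i j. a i * a j + b i * b j + c i * c j"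
  define u where "u z k = (if k = 0 then a z else if k = Suc 0 then b z else if k = 2 then c z else 0)"
    for z and k :: nat
  consider "n = 0" | "n = Suc 0" | "n = 2" | "n \<ge> 3" by linarith
  then show "det (mat n n (\<lambda>(i, j). ?K (x i) (y j))) \<ge> 0"
  proof cases
    case 1
    then show ?thesis by simp
  next
    case 2
    then have "x 0 \<in> X" "y 0 \<in> X" using xy by auto
    then show ?thesis using 2 nonneg[of "x 0"] nonneg[of "y 0"] by (simp add: det_mat_1)
  next
    case 3
    then have "x 0 < x 1" "y 0 < y 1" "x 0 \<in> X" "x 1 \<in> X" "y 0 \<in> X" "y 1 \<in> X"
      using xy by (auto simp: strict_mono_on_def)
    note m = minor2[OF this(3,4,1)] minor2[OF this(5,6,2)]
    \<comment> \<open>Cauchy-Binet for two rows: one product of minors for each of the three pairs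
      of coordinates.\<close>
    have "?K (x 0) (y 0) * ?K (x 1) (y 1) - ?K (x 0) (y 1) * ?K (x 1) (y 0) =
      (a (x 0) * b (x 1) - b (x 0) * a (x 1)) * (a (y 0) * b (y 1) - b (y 0) * a (y 1))
      + (a (x 0) * c (x 1) - c (x 0) * a (x 1)) * (a (y 0) * c (y 1) - c (y 0) * a (y 1))
      + (b (x 0) * c (x 1) - c (x 0) * b (x 1)) * (b (y 0) * c (y 1) - c (y 0) * b (y 1))"
      by (simp add: algebra_simps)
    also have "\<dots> \<ge> 0" using m by simp
    finally show ?thesis using 3 by (simp add: det_mat_2)
  next
    case 4
    let ?P = "\<lambda>z. mat n n (\<lambda>(i, k). u (z i) k)"
    have P: "det (?P z) \<ge> 0" if z: "strict_mono_on {..<n} z" "z ` {..<n} \<subseteq> X" for z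
    proof (cases "n = 3")
      case True
      then have "z 0 < z 1" "z 1 < z 2" "z 0 \<in> X" "z 1 \<in> X" "z 2 \<in> X"
        using z by (auto simp: strict_mono_on_def)
      note m = minor3[OF this(3-5,1,2)]
      then show ?thesis unfolding True det_mat_3 by (simp add: u_def algebra_simps)
    next
      case False
      \<comment> \<open>Here \<open>n\<close> is at least 4, and column 3 consists of
        padding.\<close>
      then have "det (?P z) = 0"
        using 4 by (intro det_zero_col[of 3]) (auto simp: u_def)
      then show ?thesis by simp
    qed
    have "(\<Sum>k = 0..<n. u p k * u q k) = ?K p q" for p q
    proof -
      have "(\<Sum>k = 0..<n. u p k * u q k) = (\<Sum>k = 0..<3. u p k * u q k)"
        using 4 by (intro sum.mono_neutral_right) (auto simp: u_def)
      then show ?thesis by (simp add: u_def numeral_3_eq_3 numeral_2_eq_2)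
    qed
    then have "mat n n (\<lambda>(i, j). ?K (x i) (y j)) = ?P x * transpose_mat (?P y)"
      by (intro eq_matI) (simp_all add: scalar_prod_def)
    then have "det (mat n n (\<lambda>(i, j). ?K (x i) (y j))) = det (?P x) * det (?P y)"
      by (simp add: det_mult[of _ n] det_transpose[of _ n])
    then show ?thesis using P[OF xy(1,2)] P[OF xy(3,4)] by simp
  qed
qed

section \<open>Invariance of the preserver property\<close>

lemma preserves_tn_sym_kernel_cong:
  assumes "\<And>x. x \<ge> 0 \<Longrightarrow> F x = G x"
  shows "preserves_tn_sym_kernel X F \<longleftrightarrow> preserves_tn_sym_kernel X G"
proof -
  have "tn_kernel_on X (\<lambda>x y. F (K x y)) \<longleftrightarrow> tn_kernel_on X (\<lambda>x y. G (K x y))"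
    if "tn_kernel_on X K" for K
    using that by (intro tn_kernel_on_cong assms) (auto intro: tn_kernel_on_nonneg)
  then show ?thesis unfolding preserves_tn_sym_kernel_def by blast
qed

text \<open>Extension by zero: a minor of the extended kernel that uses a point outside
  \<open>X\<close> has a zero row or column, and the others are minors of the given kernel.
  Necessity in a given size can therefore build on the results for smaller sizes.\<close>

lemma preserves_tn_sym_kernel_subset:
  assumes "preserves_tn_sym_kernel Y F" "X \<subseteq> Y"
  shows "preserves_tn_sym_kernel X F"
  unfolding preserves_tn_sym_kernel_def
proof (intro allI impI)
  fix K :: "'a \<Rightarrow> 'a \<Rightarrow> real"
  assume K: "sym_kernel_on X K" "tn_kernel_on X K"
  define K' where "K' x y = (if x \<in> X \<and> y \<in> X then K x y else 0)" for x y
  have "tn_kernel_on Y K'"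
    unfolding tn_kernel_on_def
  proof (intro allI impI)
    fix n :: nat and x y :: "nat \<Rightarrow> 'a"
    assume xy: "strict_mono_on {..<n} x" "strict_mono_on {..<n} y"
    consider "x ` {..<n} \<subseteq> X" "y ` {..<n} \<subseteq> X" | i where "i < n" "x i \<notin> X"
      | j where "j < n" "y j \<notin> X" by blast
    then show "det (mat n n (\<lambda>(i, j). K' (x i) (y j))) \<ge> 0"
    proof cases
      case 1
      have "det (mat n n (\<lambda>(i, j). K' (x i) (y j))) = det (mat n n (\<lambda>(i, j). K (x i) (y j)))"
        by (rule det_kernel_cong[of X]) (use 1 in \<open>auto simp: K'_def\<close>)
      then show ?thesis using tn_kernel_onD[OF K(2)] xy 1 by simp
    next
      case 2
      then have "det (mat n n (\<lambda>(i, j). K' (x i) (y j))) = 0"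
        by (intro det_zero_row) (auto simp: K'_def)
      then show ?thesis by simp
    next
      case 3
      then have "det (mat n n (\<lambda>(i, j). K' (x i) (y j))) = 0"
        by (intro det_zero_col) (auto simp: K'_def)
      then show ?thesis by simp
    qed
  qed
  moreover have "sym_kernel_on Y K'"
    using K(1) by (auto simp: sym_kernel_on_def K'_def)
  ultimately have "tn_kernel_on Y (\<lambda>x y. F (K' x y))"
    using assms(1) by (simp add: preserves_tn_sym_kernel_def)
  then have "tn_kernel_on X (\<lambda>x y. F (K' x y))"
    using assms(2) by (rule tn_kernel_on_subset)
  then show "tn_kernel_on X (\<lambda>x y. F (K x y))"
    by (subst (asm) tn_kernel_on_cong[of X _ "\<lambda>x y. F (K x y)"]) (simp_all add: K'_def)
qed

section \<open>Transport along order isomorphisms\<close>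

lemma tn_kernel_on_comp:
  assumes "strict_mono_on X \<phi>" "\<phi> ` X \<subseteq> Y" "tn_kernel_on Y K"
  shows "tn_kernel_on X (\<lambda>x y. K (\<phi> x) (\<phi> y))"
  unfolding tn_kernel_on_def
proof (intro allI impI)
  have *: "strict_mono_on {..<n} (\<phi> \<circ> x)" "(\<phi> \<circ> x) ` {..<n} \<subseteq> Y"
    if "strict_mono_on {..<n} x" "x ` {..<n} \<subseteq> X" for n :: nat and x
  proof (intro strict_mono_onI)
    fix r s assume rs: "r \<in> {..<n}" "s \<in> {..<n}" "r < s"
    then have "x r \<in> X" "x s \<in> X" "x r < x s"
      using that strict_mono_onD[OF that(1) rs] by auto
    then show "(\<phi> \<circ> x) r < (\<phi> \<circ> x) s"
      using strict_mono_onD[OF assms(1)] by simp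
  next
    show "(\<phi> \<circ> x) ` {..<n} \<subseteq> Y"
      using that(2) assms(2) by auto
  qed
  fix n :: nat and x y :: "nat \<Rightarrow> 'a"
  assume "strict_mono_on {..<n} x" "x ` {..<n} \<subseteq> X" "strict_mono_on {..<n} y" "y ` {..<n} \<subseteq> X"
  then show "det (mat n n (\<lambda>(i, j). K (\<phi> (x i)) (\<phi> (y j)))) \<ge> 0"
    using tn_kernel_onD[OF assms(3) *(1,2) *(1,2), of n x y] by simp
qed

lemma strict_mono_on_inverse:
  fixes \<phi> :: "'a::linorder \<Rightarrow> 'b::linorder"
  assumes "strict_mono_on X \<phi>" "\<phi> ` X = Y"
  obtains \<psi> where "strict_mono_on Y \<psi>" "\<psi> ` Y = X" "\<And>x. x \<in> X \<Longrightarrow> \<psi> (\<phi> x) = x"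
proof
  let ?\<psi> = "the_inv_into X \<phi>"
  have inj: "inj_on \<phi> X" using assms(1) by (rule strict_mono_on_imp_inj_on)
  then show inv: "?\<psi> (\<phi> x) = x" if "x \<in> X" for x
    using that by (simp add: the_inv_into_f_f)
  show "?\<psi> ` Y = X"
    using the_inv_into_onto[OF inj] assms(2) by simp
  show "strict_mono_on Y ?\<psi>"
  proof (rule strict_mono_onI)
    fix r s assume rs: "r \<in> Y" "s \<in> Y" "r < s"
    from rs(1) obtain x where x: "x \<in> X" "r = \<phi> x" using assms(2) by blast
    from rs(2) obtain y where y: "y \<in> X" "s = \<phi> y" using assms(2) by blast
    have "\<not> y \<le> x" using strict_mono_on_leD[OF assms(1), of y x] rs(3) x y by auto
    then show "?\<psi> r < ?\<psi> s" using x y inv by simp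
  qed
qed

lemma preserves_tn_sym_kernel_iso1:
  fixes \<phi> :: "'a::linorder \<Rightarrow> 'b::linorder"
  assumes \<phi>: "strict_mono_on X \<phi>" "\<phi> ` X = Y" and Y: "preserves_tn_sym_kernel Y F"
  shows "preserves_tn_sym_kernel X F"
  unfolding preserves_tn_sym_kernel_def
proof (intro allI impI)
  fix K assume K: "sym_kernel_on X K" "tn_kernel_on X K"
  obtain \<psi> where \<psi>: "strict_mono_on Y \<psi>" "\<psi> ` Y = X" and \<psi>\<phi>: "\<And>x. x \<in> X \<Longrightarrow> \<psi> (\<phi> x) = x"
    using strict_mono_on_inverse[OF \<phi>] by metis
  have "tn_kernel_on Y (\<lambda>x y. K (\<psi> x) (\<psi> y))"
    by (rule tn_kernel_on_comp[OF \<psi>(1) _ K(2)]) (simp add: \<psi>(2))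
  moreover have "sym_kernel_on Y (\<lambda>x y. K (\<psi> x) (\<psi> y))"
    using K(1) \<psi>(2) by (auto simp: sym_kernel_on_def)
  ultimately have "tn_kernel_on Y (\<lambda>x y. F (K (\<psi> x) (\<psi> y)))"
    using Y by (simp add: preserves_tn_sym_kernel_def)
  then have "tn_kernel_on X (\<lambda>x y. F (K (\<psi> (\<phi> x)) (\<psi> (\<phi> y))))"
    by (rule tn_kernel_on_comp[OF \<phi>(1), rotated]) (simp add: \<phi>(2))
  then show "tn_kernel_on X (\<lambda>x y. F (K x y))"
    by (subst (asm) tn_kernel_on_cong[of X _ "\<lambda>x y. F (K x y)"]) (simp_all add: \<psi>\<phi>)
qed

lemma preserves_tn_sym_kernel_iso:
  fixes \<phi> :: "'a::linorder \<Rightarrow> 'b::linorder"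
  assumes "strict_mono_on X \<phi>" "\<phi> ` X = Y"
  shows "preserves_tn_sym_kernel X F \<longleftrightarrow> preserves_tn_sym_kernel Y F"
  using strict_mono_on_inverse[OF assms] preserves_tn_sym_kernel_iso1 assms by metis

lemma finite_strict_mono_enum:
  fixes X :: "'a::linorder set"
  assumes "finite X"
  obtains \<phi> :: "nat \<Rightarrow> 'a" where "strict_mono_on {..<card X} \<phi>" "\<phi> ` {..<card X} = X"
proof
  let ?l = "sorted_list_of_set X"
  show "strict_mono_on {..<card X} (\<lambda>i. ?l ! i)"
    by (intro strict_mono_onI sorted_wrt_nth_less[where P = "(<)"]) simp_all
  have "set ?l = X" using assms by simp
  then show "(\<lambda>i. ?l ! i) ` {..<card X} = X"
    by (simp add: set_conv_nth image_def lessThan_def) blast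
qed

lemma preserves_tn_sym_kernel_finite:
  fixes X :: "'a::linorder set"
  assumes "finite X"
  shows "preserves_tn_sym_kernel X F \<longleftrightarrow> preserves_tn_sym_kernel {..<card X} F"
  using finite_strict_mono_enum[OF assms] preserves_tn_sym_kernel_iso by metis

lemma strict_mono_on_card_le:
  fixes x :: "nat \<Rightarrow> 'a::linorder"
  assumes "strict_mono_on {..<n} x" "x ` {..<n} \<subseteq> X" "finite X"
  shows "n \<le> card X"
  using card_inj_on_le[OF strict_mono_on_imp_inj_on[OF assms(1)] assms(2,3)] by simp

text \<open>\<open>pick S i\<close> is the element of \<open>S\<close> with exactly i smaller
  elements in \<open>S\<close>, and below \<open>x i\<close> lie precisely the values of
  \<open>x\<close> at 0, ..., i - 1.\<close>

lemma pick_image: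
  assumes "strict_mono_on {..<n} x" "i < n"
  shows "pick (x ` {..<n}) i = (x i :: nat)"
proof -
  have less: "x k < x l \<longleftrightarrow> k < l" if "k < n" "l < n" for k l
    using that strict_mono_onD[OF assms(1), of k l] strict_mono_on_leD[OF assms(1), of l k]
    by (cases "k < l") auto
  have "{a \<in> x ` {..<n}. a < x i} = x ` {..<i}"
    using assms(2) by (auto simp: less)
  then have "card {a \<in> x ` {..<n}. a < x i} = i"
    using card_image[OF inj_on_subset[OF strict_mono_on_imp_inj_on[OF assms(1)]], of "{..<i}"] assms(2)
    by auto
  then show ?thesis
    using pick_card_in_set[of "x i" "x ` {..<n}"] assms(2) by auto
qed

text \<open>Minors indexed by sets and minors indexed by increasing enumerations are the same: an
  enumeration is recovered from its range by \<open>pick_image\<close>, and a set is enumerated by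
  its own \<open>pick\<close>.\<close>

lemma tn_mat_iff_kernel:
  assumes "A \<in> carrier_mat d d"
  shows "tn_mat A \<longleftrightarrow> tn_kernel_on {..<d} (\<lambda>i j. A $$ (i, j))"
proof
  assume A: "tn_mat A"
  show "tn_kernel_on {..<d} (\<lambda>i j. A $$ (i, j))"
    unfolding tn_kernel_on_def
  proof (intro allI impI)
    fix n :: nat and x y :: "nat \<Rightarrow> nat"
    assume xy: "strict_mono_on {..<n} x" "x ` {..<n} \<subseteq> {..<d}"
      "strict_mono_on {..<n} y" "y ` {..<n} \<subseteq> {..<d}"
    let ?I = "x ` {..<n}" and ?J = "y ` {..<n}"
    have card: "card ?I = n" "card ?J = n"
      using xy(1,3)[THEN strict_mono_on_imp_inj_on, THEN card_image] by simp_all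
    have "{i. i < d \<and> i \<in> ?I} = ?I" "{i. i < d \<and> i \<in> ?J} = ?J" using xy by auto
    then have "submatrix A ?I ?J = mat n n (\<lambda>(i, j). A $$ (pick ?I i, pick ?J j))"
      using assms card by (simp add: submatrix_def)
    also have "\<dots> = mat n n (\<lambda>(i, j). A $$ (x i, y j))"
      using xy by (intro eq_matI) (simp_all add: pick_image)
    finally have "submatrix A ?I ?J = mat n n (\<lambda>(i, j). A $$ (x i, y j))" .
    moreover have "det (submatrix A ?I ?J) \<ge> 0"
      using A assms xy card by (simp add: tn_mat_def)
    ultimately show "det (mat n n (\<lambda>(i, j). A $$ (x i, y j))) \<ge> 0" by simp
  qed
next
  assume A: "tn_kernel_on {..<d} (\<lambda>i j. A $$ (i, j))"
  show "tn_mat A"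
    unfolding tn_mat_def
  proof (intro allI impI)
    fix I J assume IJ: "I \<subseteq> {..<dim_row A}" "J \<subseteq> {..<dim_col A}" "card I = card J"
    have dim: "dim_row A = d" "dim_col A = d" using assms by auto
    have pick: "strict_mono_on {..<card S} (pick S)" "pick S ` {..<card S} \<subseteq> {..<d}"
      if "S \<subseteq> {..<d}" for S
    proof -
      show "strict_mono_on {..<card S} (pick S)"
        by (intro strict_mono_onI pick_mono) auto
      show "pick S ` {..<card S} \<subseteq> {..<d}"
        using pick_in_set[of _ S] that by auto
    qed
    have "{i. i < d \<and> i \<in> I} = I" "{i. i < d \<and> i \<in> J} = J" using IJ dim by auto
    then have "submatrix A I J = mat (card I) (card I) (\<lambda>(i, j). A $$ (pick I i, pick J j))"
      using IJ(3) dim by (simp add: submatrix_def)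
    then show "det (submatrix A I J) \<ge> 0"
      using tn_kernel_onD[OF A pick(1,2)[of I] pick(1,2)[of J, folded IJ(3)]] IJ dim by simp
  qed
qed

lemma preserves_tn_sym_mat_iff_kernel:
  "preserves_tn_sym_mat d F \<longleftrightarrow> preserves_tn_sym_kernel {..<d} F"
proof
  assume mat: "preserves_tn_sym_mat d F"
  show "preserves_tn_sym_kernel {..<d} F"
    unfolding preserves_tn_sym_kernel_def
  proof (intro allI impI)
    fix K assume K: "sym_kernel_on {..<d} K" "tn_kernel_on {..<d} K"
    let ?A = "mat d d (\<lambda>(i, j). K i j)"
    have A: "?A \<in> carrier_mat d d" "map_mat F ?A \<in> carrier_mat d d" by auto
    have "transpose_mat ?A = ?A"
      using K(1) by (intro eq_matI) (auto simp: sym_kernel_on_def)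
    moreover have "tn_mat ?A"
      unfolding tn_mat_iff_kernel[OF A(1)]
      by (subst tn_kernel_on_cong[of _ _ K]) (simp_all add: K(2))
    ultimately have "tn_mat (map_mat F ?A)"
      using mat A(1) unfolding preserves_tn_sym_mat_def by blast
    then have "tn_kernel_on {..<d} (\<lambda>i j. map_mat F ?A $$ (i, j))"
      unfolding tn_mat_iff_kernel[OF A(2)] .
    then show "tn_kernel_on {..<d} (\<lambda>x y. F (K x y))"
      by (subst (asm) tn_kernel_on_cong[of _ _ "\<lambda>x y. F (K x y)"]) simp_all
  qed
next
  assume ker: "preserves_tn_sym_kernel {..<d} F"
  show "preserves_tn_sym_mat d F"
    unfolding preserves_tn_sym_mat_def
  proof (intro ballI impI)
    fix A :: "real mat"
    assume A: "A \<in> carrier_mat d d" "transpose_mat A = A" "tn_mat A"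
    have FA: "map_mat F A \<in> carrier_mat d d" using A(1) by simp
    have "sym_kernel_on {..<d} (\<lambda>i j. A $$ (i, j))"
      unfolding sym_kernel_on_def
    proof (intro ballI)
      fix i j assume "i \<in> {..<d}" "j \<in> {..<d}"
      then have "transpose_mat A $$ (i, j) = A $$ (j, i)" using A(1) by simp
      then show "A $$ (i, j) = A $$ (j, i)" using A(2) by simp
    qed
    then have "tn_kernel_on {..<d} (\<lambda>i j. F (A $$ (i, j)))"
      using ker A(3) unfolding preserves_tn_sym_kernel_def tn_mat_iff_kernel[OF A(1)] by blast
    then show "tn_mat (map_mat F A)"
      unfolding tn_mat_iff_kernel[OF FA]
      by (subst tn_kernel_on_cong[of _ _ "\<lambda>i j. F (A $$ (i, j))"]) (use A(1) in auto)
  qed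
qed

section \<open>Entrywise powers of positive semidefinite matrices\<close>

text \<open>Matrices are functions on all index pairs and \<open>n\<close> selects the leading
  block, so that an induction passes to a smaller block without changing the matrix.\<close>

definition quad :: "nat \<Rightarrow> (nat \<Rightarrow> nat \<Rightarrow> real) \<Rightarrow> (nat \<Rightarrow> real) \<Rightarrow> real" where
  "quad n A v = (\<Sum>i<n. \<Sum>j<n. v i * v j * A i j)"

definition psd :: "nat \<Rightarrow> (nat \<Rightarrow> nat \<Rightarrow> real) \<Rightarrow> bool" where
  "psd n A \<longleftrightarrow> (\<forall>i<n. \<forall>j<n. A i j = A j i) \<and> (\<forall>v. quad n A v \<ge> 0)"

text \<open>Schur complement of the pivot with index \<open>n\<close> in the leading block of size
  \<open>n + 1\<close>. Writing \<open>A j n\<close> in place of \<open>A n j\<close> makes the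
  subtracted matrix symmetric of rank at most one for every \<open>A\<close>.\<close>

definition schur :: "nat \<Rightarrow> (nat \<Rightarrow> nat \<Rightarrow> real) \<Rightarrow> nat \<Rightarrow> nat \<Rightarrow> real" where
  "schur n A i j = A i j - A i n * A j n / A n n"

lemma psd_sym: "psd n A \<Longrightarrow> i < n \<Longrightarrow> j < n \<Longrightarrow> A i j = A j i"
  by (simp add: psd_def)

lemma quad_Suc:
  assumes "\<And>i. i < n \<Longrightarrow> A n i = A i n"
  shows "quad (Suc n) A v = quad n A v + 2 * v n * (\<Sum>i<n. v i * A i n) + (v n)\<^sup>2 * A n n"
proof -
  have "(\<Sum>j<n. v n * v j * A n j) = v n * (\<Sum>i<n. v i * A i n)"
    using assms by (simp add: sum_distrib_left mult.assoc)
  moreover have "(\<Sum>i<n. v i * v n * A i n) = v n * (\<Sum>i<n. v i * A i n)"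
    by (simp add: sum_distrib_left mult_ac)
  ultimately show ?thesis
    by (simp add: quad_def sum.distrib power2_eq_square)
qed

lemma quad_rank_one: "quad n (\<lambda>i j. u i * u j * c) v = (\<Sum>i<n. v i * u i)\<^sup>2 * c"
  by (simp add: quad_def power2_eq_square sum_distrib_left sum_distrib_right mult_ac)

lemma quad_add: "quad n (\<lambda>i j. A i j + B i j) v = quad n A v + quad n B v"
  by (simp add: quad_def sum.distrib distrib_left)

lemma quad_scale: "quad n (\<lambda>i j. c * A i j) v = c * quad n A v"
  by (simp add: quad_def sum_distrib_left mult_ac)

lemma quad_schur:
  "quad n A v = quad n (schur n A) v + (\<Sum>i<n. v i * A i n)\<^sup>2 / A n n"
proof -
  have "quad n A v = quad n (\<lambda>i j. schur n A i j + A i n * A j n * (1 / A n n)) v"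
    by (simp add: quad_def schur_def)
  then show ?thesis
    unfolding quad_add quad_rank_one by simp
qed

text \<open>If the pivot vanishes, then so does its column, and the junk value of the division
  makes the Schur complement trivial.\<close>

lemma schur_last:
  assumes "A n n = 0 \<longrightarrow> (\<forall>i<n. A i n = 0)" "\<And>i. i < n \<Longrightarrow> A n i = A i n" "i \<le> n"
  shows "schur n A i n = 0" "schur n A n i = 0"
  using assms by (cases "A n n = 0"; cases "i = n"; simp add: schur_def)+

text \<open>The form at a vector with last entry s is a non-negative polynomial of degree at most
  two in s. Its leading coefficient is the pivot. If that vanishes, so must the linear coefficient;
  otherwise the minimum over s is the form of the Schur complement.\<close>

lemma psd_imp_schur:
  assumes "psd (Suc n) A"
  shows "A n n \<ge> 0" "A n n = 0 \<longrightarrow> (\<forall>i<n. A i n = 0)" "psd n (schur n A)"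
proof -
  have sym: "\<And>i. i < n \<Longrightarrow> A n i = A i n" using assms by (simp add: psd_def)
  have q: "quad n A v + 2 * s * (\<Sum>i<n. v i * A i n) + s\<^sup>2 * A n n \<ge> 0" for v s
  proof -
    have "quad (Suc n) A (v(n := s)) \<ge> 0" using assms by (simp add: psd_def)
    moreover have "quad n A (v(n := s)) = quad n A v" by (simp add: quad_def)
    moreover have "(\<Sum>i<n. (v(n := s)) i * A i n) = (\<Sum>i<n. v i * A i n)" by simp
    ultimately show ?thesis by (simp add: quad_Suc[of n A, OF sym])
  qed
  show nn: "A n n \<ge> 0"
    using q[of "\<lambda>_. 0" 1] by (simp add: quad_def)
  have zero: "(\<Sum>i<n. v i * A i n) = 0" if "A n n = 0" for v
  proof (rule ccontr)
    let ?L = "\<Sum>i<n. v i * A i n"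
    assume "?L \<noteq> 0"
    then show False
      \<comment> \<open>This s makes the left-hand side of \<open>q\<close> equal to -1.\<close>
      using q[of v "- (quad n A v + 1) / (2 * ?L)"] that by (simp add: field_simps)
  qed
  show z: "A n n = 0 \<longrightarrow> (\<forall>i<n. A i n = 0)"
  proof (intro impI allI)
    fix i assume "A n n = 0" "i < n"
    then show "A i n = 0"
      using zero[of "\<lambda>j. if j = i then 1 else 0"] by (simp add: if_distrib[of "\<lambda>x. x * _"] cong: if_cong)
  qed
  have "quad n (schur n A) v \<ge> 0" for v
  proof (cases "A n n = 0")
    case True
    then show ?thesis using q[of v 0] quad_schur[of n A v] by simp
  next
    case False
    let ?L = "\<Sum>i<n. v i * A i n"
    \<comment> \<open>The polynomial in s attains its minimum at
      \<open>- ?L / A n n\<close>.\<close>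
    have "2 * (- ?L / A n n) * ?L + (- ?L / A n n)\<^sup>2 * A n n = - (?L\<^sup>2 / A n n)"
      using False by (simp add: field_simps power2_eq_square)
    then show ?thesis using q[of v "- ?L / A n n"] quad_schur[of n A v] by simp
  qed
  moreover have "schur n A i j = schur n A j i" if "i < n" "j < n" for i j
    using assms that by (simp add: psd_def schur_def)
  ultimately show "psd n (schur n A)" by (simp add: psd_def)
qed

text \<open>Completing the square in the last variable.\<close>

lemma psd_if_schur:
  assumes sym: "\<And>i j. i < Suc n \<Longrightarrow> j < Suc n \<Longrightarrow> A i j = A j i"
    and "A n n \<ge> 0" "A n n = 0 \<longrightarrow> (\<forall>i<n. A i n = 0)" "psd n (schur n A)"
  shows "psd (Suc n) A"
  unfolding psd_def
proof (intro conjI allI impI)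
  fix v
  let ?L = "\<Sum>i<n. v i * A i n"
  have "quad (Suc n) A v = quad n (schur n A) v + (?L\<^sup>2 / A n n + 2 * v n * ?L + (v n)\<^sup>2 * A n n)"
    using sym by (subst quad_Suc) (simp_all add: quad_schur[of n A v])
  moreover have "?L\<^sup>2 / A n n + 2 * v n * ?L + (v n)\<^sup>2 * A n n \<ge> 0"
  proof (cases "A n n = 0")
    case True
    then show ?thesis using assms(3) by simp
  next
    case False
    then have "?L\<^sup>2 / A n n + 2 * v n * ?L + (v n)\<^sup>2 * A n n = (?L / A n n + v n)\<^sup>2 * A n n"
      by (simp add: field_simps power2_eq_square)
    then show ?thesis using assms(2) by simp
  qed
  ultimately show "quad (Suc n) A v \<ge> 0"
    using assms(4) by (simp add: psd_def)
qed (use sym in simp)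

lemma psd_rank_one:
  assumes "c \<ge> 0"
  shows "psd n (\<lambda>i j. u i * u j * c)"
  unfolding psd_def quad_rank_one using assms by (simp add: mult.commute)

lemma psd_add: "psd n A \<Longrightarrow> psd n B \<Longrightarrow> psd n (\<lambda>i j. A i j + B i j)"
  by (simp add: psd_def quad_add)

lemma psd_scale: "psd n A \<Longrightarrow> c \<ge> 0 \<Longrightarrow> psd n (\<lambda>i j. c * A i j)"
  by (simp add: psd_def quad_scale)

lemma psd_less: "psd (Suc n) A \<Longrightarrow> psd n A"
  unfolding psd_def
proof (intro conjI allI impI)
  assume *: "(\<forall>i<Suc n. \<forall>j<Suc n. A i j = A j i) \<and> (\<forall>v. quad (Suc n) A v \<ge> 0)"
  fix v
  have "quad (Suc n) A (v(n := 0)) \<ge> 0" using * by blast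
  then show "quad n A v \<ge> 0" by (simp add: quad_def)
qed simp

lemma quad_last_zero:
  assumes "\<And>i. i \<le> n \<Longrightarrow> A i n = 0 \<and> A n i = 0"
  shows "quad (Suc n) A v = quad n A v"
  using assms by (simp add: quad_def)

text \<open>The Schur product theorem, by induction on the size. Splitting \<open>A\<close> into its
  Schur complement and a rank one part leaves a product that lives in the smaller block, plus a
  non-negative multiple of the form of \<open>B\<close> at the vector with entries
  \<open>v i * A i n\<close>.\<close>

lemma schur_product:
  assumes "psd n A" "psd n B"
  shows "psd n (\<lambda>i j. A i j * B i j)"
  using assms
proof (induction n arbitrary: A)
  case 0
  then show ?case by (simp add: psd_def quad_def)
next
  case (Suc n)
  note schur = psd_imp_schur[OF Suc.prems(1)]
  have last: "schur n A i n = 0 \<and> schur n A n i = 0" if "i \<le> n" for i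
    using schur_last[of A n i, OF schur(2) _ that] psd_sym[OF Suc.prems(1)] by simp
  have "psd n (\<lambda>i j. schur n A i j * B i j)"
    by (rule Suc.IH[OF schur(3) psd_less[OF Suc.prems(2)]])
  moreover have "quad (Suc n) (\<lambda>i j. schur n A i j * B i j) v
      = quad n (\<lambda>i j. schur n A i j * B i j) v" for v
    by (rule quad_last_zero) (simp add: last)
  moreover have "quad (Suc n) (\<lambda>i j. A i j * B i j) v
      = quad (Suc n) (\<lambda>i j. schur n A i j * B i j) v
        + quad (Suc n) B (\<lambda>i. v i * A i n) / A n n" for v
    by (simp only: quad_def schur_def sum_divide_distrib sum.distrib[symmetric])
      (simp add: field_simps)
  moreover have "quad (Suc n) B w / A n n \<ge> 0" for w
    using Suc.prems(2) schur(1) by (simp add: psd_def)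
  ultimately have "quad (Suc n) (\<lambda>i j. A i j * B i j) v \<ge> 0" for v
    by (simp add: psd_def)
  then show ?case
    using Suc.prems by (simp add: psd_def)
qed

text \<open>Block elimination: the matrix is a product of a unit upper triangular factor and a
  factor whose last column vanishes above the pivot. Symmetry is not assumed, hence
  \<open>A n j\<close> in the complement.\<close>

lemma det_schur:
  fixes A :: "nat \<Rightarrow> nat \<Rightarrow> real"
  assumes "A n n \<noteq> 0"
  shows "det (mat (Suc n) (Suc n) (\<lambda>(i, j). A i j)) =
    A n n * det (mat n n (\<lambda>(i, j). A i j - A i n * A n j / A n n))"
proof -
  let ?B = "\<lambda>i j. A i j - A i n * A n j / A n n"
  let ?N = "Suc n"
  let ?L = "mat ?N ?N (\<lambda>(i, j). if i = j then 1 else if j = n then A i n / A n n else 0)"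
  let ?M = "mat ?N ?N (\<lambda>(i, j). if i = n then A n j else ?B i j)"
  have "mat ?N ?N (\<lambda>(i, j). A i j) = ?L * ?M"
  proof (rule eq_matI)
    fix i j assume "i < dim_row (?L * ?M)" "j < dim_col (?L * ?M)"
    then have ij: "i < ?N" "j < ?N" by auto
    have "(?L * ?M) $$ (i, j) = (\<Sum>k<?N. (if i = k then 1 else if k = n then A i n / A n n else 0)
        * (if k = n then A n j else ?B k j))"
      using ij by (simp add: scalar_prod_def atLeast0LessThan)
    also have "\<dots> = A i j"
    proof (cases "i = n")
      case True
      then show ?thesis by (simp add: sum.neutral)
    next
      case False
      have "(\<Sum>k<n. (if i = k then 1 else if k = n then A i n / A n n else 0)
        * (if k = n then A n j else ?B k j)) = (\<Sum>k<n. if k = i then ?B i j else 0)"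
        by (intro sum.cong) auto
      then show ?thesis using False ij by (simp add: times_divide_eq_left)
    qed
    finally show "mat ?N ?N (\<lambda>(i, j). A i j) $$ (i, j) = (?L * ?M) $$ (i, j)"
      using ij by simp
  qed auto
  then have "det (mat ?N ?N (\<lambda>(i, j). A i j)) = det ?L * det ?M"
    by (simp add: det_mult[of _ ?N])
  also have "det ?L = 1"
  proof -
    have "det ?L = prod_list (diag_mat ?L)"
      by (rule det_upper_triangular[of _ ?N]) auto
    also have "diag_mat ?L = map (\<lambda>_. 1) [0..<?N]"
      unfolding diag_mat_def by (rule map_cong) auto
    finally show ?thesis by (simp add: map_replicate_const)
  qed
  also have "det ?M = A n n * det (mat n n (\<lambda>(i, j). ?B i j))"
  proof -
    have "det ?M = (\<Sum>i<?N. ?M $$ (i, n) * cofactor ?M i n)"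
      by (rule laplace_expansion_column) auto
    also have "\<dots> = A n n * cofactor ?M n n"
      using assms by simp
    also have "mat_delete ?M n n = mat n n (\<lambda>(i, j). ?B i j)"
      by (rule eq_matI) (auto simp: mat_delete_def)
    then have "cofactor ?M n n = det (mat n n (\<lambda>(i, j). ?B i j))"
      by (simp add: cofactor_def)
    finally show ?thesis .
  qed
  finally show ?thesis by simp
qed

text \<open>Induction along \<open>det_schur\<close>; a vanishing pivot forces a zero
  column.\<close>

lemma psd_det_nonneg:
  assumes "psd n A"
  shows "det (mat n n (\<lambda>(i, j). A i j)) \<ge> 0"
  using assms
proof (induction n arbitrary: A)
  case 0
  then show ?case by simp
next
  case (Suc n)
  note schur = psd_imp_schur[OF Suc.prems]
  show ?case
  proof (cases "A n n = 0")
    case True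
    then have "det (mat (Suc n) (Suc n) (\<lambda>(i, j). A i j)) = 0"
      using schur(2) by (intro det_zero_col[of n]) (auto simp: less_Suc_eq)
    then show ?thesis by simp
  next
    case False
    have "mat n n (\<lambda>(i, j). A i j - A i n * A n j / A n n) = mat n n (\<lambda>(i, j). schur n A i j)"
      using psd_sym[OF Suc.prems] by (intro eq_matI) (simp_all add: schur_def)
    then show ?thesis
      using det_schur[of A, OF False] Suc.IH[OF schur(3)] schur(1) by simp
  qed
qed

text \<open>Sylvester's criterion in the form with all principal minors. A principal minor of the
  Schur complement, multiplied by the pivot, is the principal minor of \<open>A\<close> with the
  index \<open>n\<close> added. A vanishing pivot kills its column, because the minor on {i, n} is
  then minus a square.\<close>

lemma psd_if_principal_minors:
  assumes "\<And>i j. i < n \<Longrightarrow> j < n \<Longrightarrow> A i j = A j i"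
    and "\<And>(m::nat) x. strict_mono_on {..<m} x \<Longrightarrow> x ` {..<m} \<subseteq> {..<n} \<Longrightarrow>
      det (mat m m (\<lambda>(i, j). A (x i) (x j))) \<ge> 0"
  shows "psd n A"
  using assms
proof (induction n arbitrary: A)
  case 0
  then show ?case by (simp add: psd_def quad_def)
next
  case (Suc n)
  have sm1: "strict_mono_on {..<Suc 0} (\<lambda>_. n)" by (rule strict_mono_onI) simp
  have nn: "A n n \<ge> 0"
    using Suc.prems(2)[OF sm1] by (simp add: det_mat_1 image_subset_iff)
  have zero: "A i n = 0" if "A n n = 0" "i < n" for i
  proof -
    let ?x = "\<lambda>k::nat. if k = 0 then i else n"
    have "strict_mono_on {..<2} ?x" "?x ` {..<2} \<subseteq> {..<Suc n}"
      using that by (auto simp: strict_mono_on_def)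
    then have "A i i * A n n - A i n * A n i \<ge> 0"
      using Suc.prems(2)[of 2 ?x] by (simp add: det_mat_2)
    moreover have "A n i = A i n" using Suc.prems(1) that by simp
    ultimately show ?thesis using that zero_le_square[of "A i n"] by auto
  qed
  have "psd n (schur n A)"
  proof (rule Suc.IH)
    show "schur n A i j = schur n A j i" if "i < n" "j < n" for i j
      using that Suc.prems(1) by (simp add: schur_def)
  next
    fix m :: nat and x assume x: "strict_mono_on {..<m} x" "x ` {..<m} \<subseteq> {..<n}"
    show "det (mat m m (\<lambda>(i, j). schur n A (x i) (x j))) \<ge> 0"
    proof (cases "A n n = 0")
      case True
      have "x ` {..<m} \<subseteq> {..<Suc n}" using x(2) by auto
      then show ?thesis using Suc.prems(2)[OF x(1)] True by (simp add: schur_def)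
    next
      case False
      \<comment> \<open>The index set enlarged by \<open>n\<close>, which becomes its largest
        element.\<close>
      let ?x = "x(m := n)"
      have "strict_mono_on {..<Suc m} ?x"
      proof (rule strict_mono_onI)
        fix r s assume "r \<in> {..<Suc m}" "s \<in> {..<Suc m}" "r < s"
        then show "?x r < ?x s"
          using strict_mono_onD[OF x(1), of r s] x(2) by auto
      qed
      moreover have "?x ` {..<Suc m} \<subseteq> {..<Suc n}"
        using x(2) by (auto simp: image_subset_iff less_Suc_eq)
      ultimately have "0 \<le> det (mat (Suc m) (Suc m) (\<lambda>(i, j). A (?x i) (?x j)))"
        by (rule Suc.prems(2))
      also have "\<dots> = A n n * det (mat m m (\<lambda>(i, j). A (?x i) (?x j) - A (?x i) (?x m) * A (?x m) (?x j) / A n n))"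
        using det_schur[of "\<lambda>i j. A (?x i) (?x j)" m] False by simp
      also have "mat m m (\<lambda>(i, j). A (?x i) (?x j) - A (?x i) (?x m) * A (?x m) (?x j) / A n n)
          = mat m m (\<lambda>(i, j). schur n A (x i) (x j))"
      proof (rule eq_matI)
        fix i j assume "i < dim_row (mat m m (\<lambda>(i, j). schur n A (x i) (x j)))"
          "j < dim_col (mat m m (\<lambda>(i, j). schur n A (x i) (x j)))"
        then have ij: "i < m" "j < m" by auto
        then have "x j < n" using x(2) by auto
        then have "A n (x j) = A (x j) n" using Suc.prems(1) by simp
        then show "mat m m (\<lambda>(i, j). A (?x i) (?x j) - A (?x i) (?x m) * A (?x m) (?x j) / A n n) $$ (i, j)
          = mat m m (\<lambda>(i, j). schur n A (x i) (x j)) $$ (i, j)"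
          using ij by (simp add: schur_def)
      qed auto
      finally show ?thesis using nn False by (simp add: zero_le_mult_iff)
    qed
  qed
  then show ?case using Suc.prems(1) nn zero by (intro psd_if_schur) auto
qed

text \<open>In size two, besides the non-negative diagonal only one product inequality counts, and
  \<open>powr\<close> preserves it. The convention \<open>0 powr 0 = 0\<close> keeps zero entries
  zero also for \<alpha> = 0.\<close>

lemma psd_2_powr:
  assumes psd: "psd 2 A" and nonneg: "\<And>i j. i < 2 \<Longrightarrow> j < 2 \<Longrightarrow> A i j \<ge> 0" and "\<alpha> \<ge> 0"
  shows "psd 2 (\<lambda>i j. A i j powr \<alpha>)"
proof -
  have A: "A 0 0 \<ge> 0" "A 1 1 \<ge> 0" "A 0 1 \<ge> 0" "A 1 0 = A 0 1"
    using nonneg psd_sym[OF psd] by simp_all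
  have "0 \<le> det (mat 2 2 (\<lambda>(i, j). A i j))" by (rule psd_det_nonneg[OF psd])
  then have le: "A 0 1 * A 0 1 \<le> A 0 0 * A 1 1"
    using A by (simp add: det_mat_2)
  then have pow: "A 0 1 powr \<alpha> * A 0 1 powr \<alpha> \<le> A 0 0 powr \<alpha> * A 1 1 powr \<alpha>"
    using A assms(3) powr_mono2[of \<alpha> "A 0 1 * A 0 1" "A 0 0 * A 1 1"] by (simp add: powr_mult)
  have zero: "A 0 1 = 0" if "A 1 1 = 0"
    using le that by (metis mult_zero_right not_square_less_zero order_antisym_conv linorder_not_less mult_eq_0_iff)
  have "psd (Suc 1) (\<lambda>i j. A i j powr \<alpha>)"
  proof (rule psd_if_schur)
    show "A i j powr \<alpha> = A j i powr \<alpha>" if "i < Suc 1" "j < Suc 1" for i j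
      using psd_sym[OF psd, of i j] that by simp
    show "psd 1 (schur 1 (\<lambda>i j. A i j powr \<alpha>))"
    proof -
      have "schur 1 (\<lambda>i j. A i j powr \<alpha>) 0 0 \<ge> 0"
        using pow A by (cases "A 1 1 = 0") (simp_all add: schur_def field_simps)
      then show ?thesis by (simp add: psd_def quad_def)
    qed
  qed (use zero in auto)
  then show ?thesis by (simp add: numeral_2_eq_2)
qed

text \<open>The FitzGerald--Horn theorem. Along the segment from the rank one matrix \<open>R\<close> with the
  same last column as \<open>A\<close> to \<open>A\<close>, the derivative of the quadratic form of the entrywise power is
  the quadratic form of a Schur product of smaller positive semidefinite matrices, one of them an
  entrywise power with exponent decreased by one.\<close>

lemma psd_powr:
  assumes "n \<ge> 2" "psd n A" "\<And>i j. i < n \<Longrightarrow> j < n \<Longrightarrow> A i j \<ge> 0" "\<alpha> \<ge> real n - 2"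
  shows "psd n (\<lambda>i j. A i j powr \<alpha>)"
  using assms
proof (induction n arbitrary: A \<alpha> rule: nat_induct_at_least)
  case base
  then show ?case by (intro psd_2_powr) auto
next
  case (Suc n)
  note schur = psd_imp_schur[OF Suc.prems(1)]
  have \<alpha>: "\<alpha> \<ge> 1" "\<alpha> - 1 \<ge> real n - 2" using Suc.prems(3) Suc.hyps by simp_all
  define R where "R i j = A i n * A j n / A n n" for i j
  have A_eq: "A i j = R i j + schur n A i j" for i j by (simp add: R_def schur_def)
  have R: "R i j \<ge> 0" if "i < Suc n" "j < Suc n" for i j
    using that Suc.prems(2) schur(1) by (simp add: R_def)
  have last: "schur n A i n = 0 \<and> schur n A n i = 0" if "i \<le> n" for i
    using schur_last[of A n i, OF schur(2) _ that] psd_sym[OF Suc.prems(1)] by simp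
  let ?C = "\<lambda>l i j. R i j + l * schur n A i j"
  have C_eq: "?C l i j = (1 - l) * R i j + l * A i j" for l i j
    by (simp add: A_eq algebra_simps)
  have C: "?C l i j \<ge> 0" if "0 \<le> l" "l \<le> 1" "i < Suc n" "j < Suc n" for l i j
    unfolding C_eq using that R Suc.prems(2) by simp
  have quad_C: "quad (Suc n) (\<lambda>i j. ?C 0 i j powr \<alpha>) v \<le> quad (Suc n) (\<lambda>i j. ?C 1 i j powr \<alpha>) v" for v
  proof (rule DERIV_nonneg_imp_increasing_open
      [where f = "\<lambda>l. quad (Suc n) (\<lambda>i j. ?C l i j powr \<alpha>) v" and a = 0 and b = 1])
    show "continuous_on {0..1} (\<lambda>l. quad (Suc n) (\<lambda>i j. ?C l i j powr \<alpha>) v)"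
      unfolding quad_def
      by (intro continuous_intros continuous_on_powr') (use \<alpha>(1) C in auto)
  next
    fix l :: real assume l: "0 < l" "l < 1"
    let ?D = "\<lambda>i j. \<alpha> * (schur n A i j * ?C l i j powr (\<alpha> - 1))"
    have deriv: "((\<lambda>l. ?C l i j powr \<alpha>) has_real_derivative ?D i j) (at l)"
      if "i < Suc n" "j < Suc n" for i j
    proof (cases "?C l i j = 0")
      case True
      \<comment> \<open>An inner point of a segment between non-negative numbers vanishes only if
        both ends do. This entry is then zero along the whole segment, and \<open>powr\<close> never
        has to be differentiated at 0.\<close>
      have "(1 - l) * R i j \<ge> 0" "l * A i j \<ge> 0" using that l R Suc.prems(2) by simp_all
      then have "(1 - l) * R i j = 0" "l * A i j = 0"
        using True unfolding C_eq by linarith+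
      then have "R i j = 0" "A i j = 0" using l by auto
      then have "R i j = 0" "schur n A i j = 0" using A_eq[of i j] by auto
      then show ?thesis by simp
    next
      case False
      then have "?C l i j > 0" using C[of l i j] that l by simp
      then show ?thesis
        by (auto intro!: derivative_eq_intros simp: powr_diff)
    qed
    have "((\<lambda>l. quad (Suc n) (\<lambda>i j. ?C l i j powr \<alpha>) v) has_real_derivative
        quad (Suc n) ?D v) (at l)"
      unfolding quad_def by (intro DERIV_sum DERIV_cmult) (simp add: deriv)
    moreover have "quad (Suc n) ?D v \<ge> 0"
    proof -
      have "psd n R" unfolding R_def
        using psd_rank_one[of "1 / A n n" n "\<lambda>i. A i n"] schur(1) by simp
      then have "psd n (?C l)"
        using psd_add[OF _ psd_scale[OF schur(3)], of R l] l by simp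
      \<comment> \<open>Size and exponent drop by one together, as the induction hypothesis
        requires.\<close>
      then have "psd n (\<lambda>i j. ?C l i j powr (\<alpha> - 1))"
        using C[of l] l \<alpha>(2) by (intro Suc.IH) auto
      then have "psd n ?D"
        using schur_product[OF schur(3)] psd_scale[of n _ \<alpha>] \<alpha>(1) by simp
      \<comment> \<open>The last row and column of the Schur complement vanish, so the derivative
        sees only the smaller block.\<close>
      moreover have "quad (Suc n) ?D v = quad n ?D v"
        by (rule quad_last_zero) (simp add: last)
      ultimately show ?thesis by (simp add: psd_def)
    qed
    ultimately show "\<exists>y. ((\<lambda>l. quad (Suc n) (\<lambda>i j. ?C l i j powr \<alpha>) v) has_real_derivative y) (at l) \<and> y \<ge> 0"
      by blast
  qed simp
  \<comment> \<open>At the rank one end of the segment the entrywise power is again of rank at most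
    one.\<close>
  have quad_R: "quad (Suc n) (\<lambda>i j. R i j powr \<alpha>) v \<ge> 0" for v
  proof -
    have "R i j powr \<alpha> = A i n powr \<alpha> * A j n powr \<alpha> * (1 / A n n powr \<alpha>)"
      if "i < Suc n" "j < Suc n" for i j
      using that Suc.prems(2) by (simp add: R_def powr_divide powr_mult)
    then have "quad (Suc n) (\<lambda>i j. R i j powr \<alpha>) v
        = quad (Suc n) (\<lambda>i j. A i n powr \<alpha> * A j n powr \<alpha> * (1 / A n n powr \<alpha>)) v"
      unfolding quad_def by (intro sum.cong) auto
    then show ?thesis unfolding quad_rank_one by simp
  qed
  have "quad (Suc n) (\<lambda>i j. A i j powr \<alpha>) v \<ge> 0" for v
    using quad_C[of v] quad_R[of v] unfolding C_eq by simp
  then show ?case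
    using Suc.prems(1) by (simp add: psd_def)
qed

section \<open>Sufficiency\<close>

lemma powr_ge_tangent:
  fixes x \<alpha> :: real
  assumes "x \<ge> 0" "\<alpha> \<ge> 1"
  shows "x powr \<alpha> \<ge> 1 + \<alpha> * (x - 1)"
proof (cases "x = 0")
  case True
  then show ?thesis using assms by simp
next
  case False
  have "x powr \<alpha> - 1 powr \<alpha> \<ge> \<alpha> * (x - 1)"
    using False assms
    by (intro convex_on_imp_above_tangent[OF powr_convex[OF assms(2)]])
      (auto intro!: derivative_eq_intros simp: interior_open)
  then show ?thesis by simp
qed

text \<open>The tangent of the power at 1 compares both sides with the given inequality multiplied
  by the square of \<alpha>: it bounds the factors on the left from above and those on the right
  from below.\<close>

lemma powr_minor_ineq:
  fixes P Q r s \<alpha> :: real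
  assumes "P \<ge> 1" "Q \<ge> 1" "0 \<le> r" "r \<le> 1" "0 \<le> s" "s \<le> 1" "\<alpha> \<ge> 1"
    and "(1 - r) * (1 - s) \<le> (P - 1) * (Q - 1)"
  shows "(1 - r powr \<alpha>) * (1 - s powr \<alpha>) \<le> (P powr \<alpha> - 1) * (Q powr \<alpha> - 1)"
proof -
  have le: "1 - x powr \<alpha> \<le> \<alpha> * (1 - x)" "0 \<le> 1 - x powr \<alpha>" if "0 \<le> x" "x \<le> 1" for x
    using powr_ge_tangent[of x \<alpha>] that assms(7) powr_mono2[of \<alpha> x 1]
    by (auto simp: algebra_simps)
  have ge: "\<alpha> * (x - 1) \<le> x powr \<alpha> - 1" "0 \<le> \<alpha> * (x - 1)" if "x \<ge> 1" for x
    using powr_ge_tangent[of x \<alpha>] that assms(7) by auto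
  have "(1 - r powr \<alpha>) * (1 - s powr \<alpha>) \<le> (\<alpha> * (1 - r)) * (\<alpha> * (1 - s))"
    using assms le by (intro mult_mono) auto
  also have "\<dots> = \<alpha>\<^sup>2 * ((1 - r) * (1 - s))" by (simp add: power2_eq_square)
  also have "\<dots> \<le> \<alpha>\<^sup>2 * ((P - 1) * (Q - 1))" using assms(8) by (intro mult_left_mono) auto
  also have "\<dots> = (\<alpha> * (P - 1)) * (\<alpha> * (Q - 1))" by (simp add: power2_eq_square)
  also have "\<dots> \<le> (P powr \<alpha> - 1) * (Q powr \<alpha> - 1)"
    using assms ge order_trans[OF ge(2) ge(1)] by (intro mult_mono) auto
  finally show ?thesis .
qed

text \<open>Condensation at the central entry: e times the determinant equals (ae - bd)(ei - fh) -
  (bf - ce)(dh - eg). The same identity holds for the powers, and dividing by bdfh brings both to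
  the shape of \<open>powr_minor_ineq\<close>.\<close>

lemma det3_powr_nonneg:
  fixes a b c d e f g h i \<alpha> :: real
  assumes nn: "a \<ge> 0" "b \<ge> 0" "c \<ge> 0" "d \<ge> 0" "e \<ge> 0" "f \<ge> 0" "g \<ge> 0" "h \<ge> 0" "i \<ge> 0"
    and m: "b * d \<le> a * e" "f * h \<le> e * i" "c * e \<le> b * f" "e * g \<le> d * h"
    and det: "a * (e * i - f * h) - b * (d * i - f * g) + c * (d * h - e * g) \<ge> 0"
    and \<alpha>: "\<alpha> \<ge> 1"
  shows "a powr \<alpha> * (e powr \<alpha> * i powr \<alpha> - f powr \<alpha> * h powr \<alpha>)
    - b powr \<alpha> * (d powr \<alpha> * i powr \<alpha> - f powr \<alpha> * g powr \<alpha>)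
    + c powr \<alpha> * (d powr \<alpha> * h powr \<alpha> - e powr \<alpha> * g powr \<alpha>) \<ge> 0"
    (is "?D \<ge> 0")
proof -
  define p where "p x = x powr \<alpha>" for x :: real
  have p_mult: "p (x * y) = p x * p y" if "x \<ge> 0" "y \<ge> 0" for x y
    using that by (simp add: p_def powr_mult)
  have p_mono: "p x \<le> p y" if "0 \<le> x" "x \<le> y" for x y
    using that \<alpha> by (simp add: p_def powr_mono2)
  have p_nn: "p x \<ge> 0" for x by (simp add: p_def)
  have p0: "p 0 = 0" by (simp add: p_def)
  have D: "?D = p a * (p e * p i - p f * p h) - p b * (p d * p i - p f * p g) + p c * (p d * p h - p e * p g)"
    by (simp add: p_def)
  have eD: "p e * ?D = (p a * p e - p b * p d) * (p e * p i - p f * p h)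
      - (p b * p f - p c * p e) * (p d * p h - p e * p g)"
    unfolding D by (simp add: algebra_simps)
  have pm: "p b * p d \<le> p a * p e" "p f * p h \<le> p e * p i" "p c * p e \<le> p b * p f" "p e * p g \<le> p d * p h"
    using p_mono[OF _ m(1)] p_mono[OF _ m(2)] p_mono[OF _ m(3)] p_mono[OF _ m(4)] nn
    by (simp_all add: p_mult)
  show ?thesis
  proof (cases "e = 0")
    case True
    then have pe: "p e = 0" using p0 by simp
    \<comment> \<open>With e = 0 the minors force bd = fh = 0, which kills all negative terms of the
      determinant.\<close>
    have zero: "p b * p d = 0" "p f * p h = 0"
      using pm(1,2) mult_nonneg_nonneg[OF p_nn p_nn, of b d] mult_nonneg_nonneg[OF p_nn p_nn, of f h]
      unfolding pe by linarith+
    have "?D = p a * (p e * p i) - p a * (p f * p h) - (p b * p d) * p i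
        + p b * p f * p g + p c * p d * p h - p c * (p e * p g)"
      unfolding D by (simp add: algebra_simps)
    then have "?D = p b * p f * p g + p c * p d * p h"
      unfolding zero pe by simp
    then show ?thesis using p_nn by (simp only: add_nonneg_nonneg mult_nonneg_nonneg)
  next
    case False
    then have e: "e > 0" "p e > 0" using nn by (simp_all add: p_def)
    have "p e * ?D \<ge> 0"
    proof (cases "b * f = 0 \<or> d * h = 0")
      case True
      \<comment> \<open>One of the two minors in the subtracted product is squeezed to zero.\<close>
      then have "p b * p f = 0 \<or> p d * p h = 0"
        using p0 by auto
      then have "(p b * p f - p c * p e = 0) \<or> (p d * p h - p e * p g = 0)"
        using pm(3,4) p_nn e
        by (smt (verit) mult_nonneg_nonneg)
      then show ?thesis unfolding eD using pm(1,2) by auto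
    next
      case False
      then have pos: "b > 0" "f > 0" "d > 0" "h > 0" using nn by (auto simp: less_le)
      \<comment> \<open>After the division each of the four minors is a difference of 1 and one of
        these ratios.\<close>
      let ?P = "a * e / (b * d)" and ?Q = "e * i / (f * h)" and ?r = "c * e / (b * f)" and ?s = "e * g / (d * h)"
      have q: "p (x / y) = p x / p y" if "x \<ge> 0" "y > 0" for x y
        using that by (simp add: p_def powr_divide)
      have "e * (a * (e * i - f * h) - b * (d * i - f * g) + c * (d * h - e * g)) \<ge> 0"
        using det e by simp
      then have "(b * f - c * e) * (d * h - e * g) \<le> (a * e - b * d) * (e * i - f * h)"
        by (simp add: algebra_simps)
      then have "(b * f - c * e) * (d * h - e * g) / (b * d * f * h)
          \<le> (a * e - b * d) * (e * i - f * h) / (b * d * f * h)"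
        using pos by (intro divide_right_mono) auto
      moreover have "(b * f - c * e) * (d * h - e * g) / (b * d * f * h) = (1 - ?r) * (1 - ?s)"
        using pos by (simp add: field_simps)
      moreover have "(a * e - b * d) * (e * i - f * h) / (b * d * f * h) = (?P - 1) * (?Q - 1)"
        using pos by (simp add: field_simps)
      ultimately have "(1 - ?r) * (1 - ?s) \<le> (?P - 1) * (?Q - 1)" by simp
      then have "(1 - ?r powr \<alpha>) * (1 - ?s powr \<alpha>) \<le> (?P powr \<alpha> - 1) * (?Q powr \<alpha> - 1)"
        using pos nn m \<alpha> by (intro powr_minor_ineq) (simp_all add: divide_simps mult_ac)
      then have le: "(1 - p ?r) * (1 - p ?s) \<le> (p ?P - 1) * (p ?Q - 1)"
        by (simp only: p_def)
      have ppos: "p b > 0" "p f > 0" "p d > 0" "p h > 0" using pos by (simp_all add: p_def)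
      have "p ?r = p c * p e / (p b * p f)" "p ?s = p e * p g / (p d * p h)"
        "p ?P = p a * p e / (p b * p d)" "p ?Q = p e * p i / (p f * p h)"
        using pos nn by (simp_all add: q p_mult)
      note le' = le[unfolded this]
      have "p e * ?D = (p b * p d * p f * p h) *
        ((p a * p e / (p b * p d) - 1) * (p e * p i / (p f * p h) - 1)
          - (1 - p c * p e / (p b * p f)) * (1 - p e * p g / (p d * p h)))"
        unfolding eD using ppos by (simp add: field_simps)
      also have "\<dots> \<ge> 0"
        using le' ppos by (intro mult_nonneg_nonneg) auto
      finally show ?thesis .
    qed
    then show ?thesis using e(2) by (simp add: zero_le_mult_iff)
  qed
qed

text \<open>Symmetry is not assumed, so that the non-principal minors of a symmetric kernel of size
  four are covered as well.\<close>

lemma tn_kernel_powr_det: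
  fixes K :: "'a::linorder \<Rightarrow> 'a \<Rightarrow> real"
  assumes K: "tn_kernel_on X K" and "n \<le> 3" "\<alpha> \<ge> 1"
    and xy: "strict_mono_on {..<n} x" "x ` {..<n} \<subseteq> X" "strict_mono_on {..<n} y" "y ` {..<n} \<subseteq> X"
  shows "det (mat n n (\<lambda>(i, j). K (x i) (y j) powr \<alpha>)) \<ge> 0"
proof -
  have nn: "K (x i) (y j) \<ge> 0" if "i < n" "j < n" for i j
    using tn_kernel_on_nonneg[OF K] xy that by (simp add: image_subset_iff)
  have m2: "K (x i) (y l) * K (x j) (y k) \<le> K (x i) (y k) * K (x j) (y l)"
    if "i < j" "j < n" "k < l" "l < n" for i j k l
  proof -
    have "x i < x j" "y k < y l" using xy that by (auto simp: strict_mono_on_def)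
    then show ?thesis
      using tn_kernel_on_minor2[OF K, of "x i" "x j" "y k" "y l"] xy that
      by (simp add: image_subset_iff)
  qed
  consider "n = 0" | "n = Suc 0" | "n = 2" | "n = 3" using assms(2) by linarith
  then show ?thesis
  proof cases
    case 3
    have "(K (x 0) (y 1) * K (x 1) (y 0)) powr \<alpha> \<le> (K (x 0) (y 0) * K (x 1) (y 1)) powr \<alpha>"
      using m2[of 0 1 0 1] nn 3 assms(3) by (intro powr_mono2) auto
    then show ?thesis using nn 3 by (simp add: det_mat_2 powr_mult)
  next
    case 4
    have "0 \<le> K (x 0) (y 0) * (K (x 1) (y 1) * K (x 2) (y 2) - K (x 1) (y 2) * K (x 2) (y 1))
        - K (x 0) (y 1) * (K (x 1) (y 0) * K (x 2) (y 2) - K (x 1) (y 2) * K (x 2) (y 0))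
        + K (x 0) (y 2) * (K (x 1) (y 0) * K (x 2) (y 1) - K (x 1) (y 1) * K (x 2) (y 0))"
      using tn_kernel_onD[OF K xy] unfolding 4 det_mat_3 by simp
    then show ?thesis
      unfolding 4 det_mat_3 prod.case
      using nn m2[of 0 1 0 1] m2[of 1 2 1 2] m2[of 0 1 1 2] m2[of 1 2 0 1] assms(3) 4
      by (intro det3_powr_nonneg) (simp_all add: mult.commute)
  qed (simp_all add: det_mat_1)
qed

section \<open>Preservers in each size\<close>

lemma preserves_tn_sym_kernel_scale:
  assumes "preserves_tn_sym_kernel X F" "c \<ge> 0"
  shows "preserves_tn_sym_kernel X (\<lambda>x. c * F x)"
  using assms tn_kernel_on_scale unfolding preserves_tn_sym_kernel_def by blast

lemma preserves_tn_sym_kernel_const: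
  assumes "nonneg_constant F"
  shows "preserves_tn_sym_kernel X F"
proof -
  obtain c where c: "c \<ge> 0" "\<And>x. x \<ge> 0 \<Longrightarrow> F x = c"
    using assms by (auto simp: nonneg_constant_def)
  \<comment> \<open>A constant is the Gram kernel of one repeated point.\<close>
  have "tn_kernel_on X (\<lambda>x y. sqrt c * sqrt c + 0 * 0 + 0 * 0)"
    by (rule tn_kernel_on_gram) (use c in auto)
  then have "tn_kernel_on X (\<lambda>x y. c)" using c by simp
  then have "preserves_tn_sym_kernel X (\<lambda>_. c)" by (simp add: preserves_tn_sym_kernel_def)
  then show ?thesis by (subst preserves_tn_sym_kernel_cong[of F "\<lambda>_. c"]) (use c in auto)
qed

lemma preserves_tn_sym_kernel_linear:
  assumes "case_e F"
  shows "preserves_tn_sym_kernel X F"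
proof -
  obtain c where c: "c > 0" "\<And>x. x \<ge> 0 \<Longrightarrow> F x = c * x"
    using assms by (auto simp: case_e_def)
  have "preserves_tn_sym_kernel X (\<lambda>x. x)" by (simp add: preserves_tn_sym_kernel_def)
  then have "preserves_tn_sym_kernel X (\<lambda>x. c * x)"
    using c by (intro preserves_tn_sym_kernel_scale) auto
  then show ?thesis by (subst preserves_tn_sym_kernel_cong[of F "\<lambda>x. c * x"]) (use c in auto)
qed

lemma preserves_tn_sym_kernel_1:
  assumes "case_a F"
  shows "preserves_tn_sym_kernel {..<1::nat} F"
  unfolding preserves_tn_sym_kernel_def
proof (intro allI impI)
  fix K assume K: "tn_kernel_on {..<1::nat} K"
  show "tn_kernel_on {..<1} (\<lambda>x y. F (K x y))"
    unfolding tn_kernel_on_def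
  proof (intro allI impI)
    fix n and x y :: "nat \<Rightarrow> nat"
    assume xy: "strict_mono_on {..<n} x" "x ` {..<n} \<subseteq> {..<1}"
      "strict_mono_on {..<n} y" "y ` {..<n} \<subseteq> {..<1}"
    have "n \<le> 1" using strict_mono_on_card_le[OF xy(1,2)] by simp
    then consider "n = 0" | "n = Suc 0" by linarith
    then show "det (mat n n (\<lambda>(i, j). F (K (x i) (y j)))) \<ge> 0"
    proof cases
      case 2
      then have "K (x 0) (y 0) \<ge> 0" using tn_kernel_on_nonneg[OF K] xy by (simp add: image_subset_iff)
      then show ?thesis using assms 2 by (simp add: det_mat_1 case_a_def)
    qed simp
  qed
qed

text \<open>By counting, the range is everything, and \<open>pick\<close> enumerates it in order.
  This identifies a minor of full size with the whole symmetric kernel.\<close>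

lemma strict_mono_on_lessThan_id:
  fixes x :: "nat \<Rightarrow> nat"
  assumes "strict_mono_on {..<n} x" "x ` {..<n} \<subseteq> {..<n}" "i < n"
  shows "x i = i"
proof -
  have "x ` {..<n} = {..<n}"
    using assms card_image[OF strict_mono_on_imp_inj_on[OF assms(1)]]
    by (intro card_subset_eq) auto
  then show ?thesis
    using pick_image[OF assms(1,3)] pick_image[of n "\<lambda>i. i" i] assms(3)
    by (simp add: strict_mono_on_def)
qed

text \<open>Monotonicity replaces b by the geometric mean of a and c, where mid-convexity
  applies.\<close>

lemma case_b_minor:
  assumes "case_b F" "a \<ge> 0" "b \<ge> 0" "c \<ge> 0" "b * b \<le> a * c"
  shows "F b * F b \<le> F a * F c"
proof -
  have "b \<le> sqrt (a * c)" using assms by (simp add: real_le_rsqrt power2_eq_square)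
  then have "F b \<le> F (sqrt (a * c))"
    using assms mono_onD[of "{0..}" F b "sqrt (a * c)"] by (simp add: case_b_def)
  then have "F b * F b \<le> (F (sqrt (a * c)))\<^sup>2"
    unfolding power2_eq_square using assms by (intro mult_mono) (auto simp: case_b_def)
  also have "\<dots> \<le> F a * F c" using assms by (auto simp: case_b_def mult_mid_convex_def)
  finally show ?thesis .
qed

lemma preserves_tn_sym_kernel_2:
  assumes "case_b F"
  shows "preserves_tn_sym_kernel {..<2::nat} F"
  unfolding preserves_tn_sym_kernel_def
proof (intro allI impI)
  fix K assume K: "sym_kernel_on {..<2::nat} K" "tn_kernel_on {..<2} K"
  show "tn_kernel_on {..<2} (\<lambda>x y. F (K x y))"
    unfolding tn_kernel_on_def
  proof (intro allI impI)
    fix n and x y :: "nat \<Rightarrow> nat"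
    assume xy: "strict_mono_on {..<n} x" "x ` {..<n} \<subseteq> {..<2}"
      "strict_mono_on {..<n} y" "y ` {..<n} \<subseteq> {..<2}"
    have "n \<le> 2" using strict_mono_on_card_le[OF xy(1,2)] by simp
    then consider "n = 0" | "n = Suc 0" | "n = 2" by linarith
    then show "det (mat n n (\<lambda>(i, j). F (K (x i) (y j)))) \<ge> 0"
    proof cases
      case 2
      then have "K (x 0) (y 0) \<ge> 0" using tn_kernel_on_nonneg[OF K(2)] xy by (simp add: image_subset_iff)
      then show ?thesis using assms 2 by (simp add: det_mat_1 case_b_def)
    next
      case 3
      then have id: "x 0 = 0" "x 1 = 1" "y 0 = 0" "y 1 = 1"
        using strict_mono_on_lessThan_id[of 2] xy by auto
      have "K 1 0 = K 0 1" using K(1) by (simp add: sym_kernel_on_def)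
      moreover have "F (K 0 1) * F (K 0 1) \<le> F (K 0 0) * F (K 1 1)"
        using tn_kernel_on_minor2[OF K(2), of 0 1 0 1] calculation
        by (intro case_b_minor[OF assms] tn_kernel_on_nonneg[OF K(2)]) auto
      ultimately show ?thesis using 3 id by (simp add: det_mat_2)
    qed simp
  qed
qed

lemma preserves_tn_sym_kernel_3:
  assumes "\<alpha> \<ge> 1"
  shows "preserves_tn_sym_kernel {..<3::nat} (\<lambda>x. x powr \<alpha>)"
  unfolding preserves_tn_sym_kernel_def
proof (intro allI impI)
  fix K assume K: "tn_kernel_on {..<3::nat} K"
  show "tn_kernel_on {..<3} (\<lambda>x y. K x y powr \<alpha>)"
    unfolding tn_kernel_on_def
  proof (intro allI impI)
    fix n and x y :: "nat \<Rightarrow> nat"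
    assume xy: "strict_mono_on {..<n} x" "x ` {..<n} \<subseteq> {..<3}"
      "strict_mono_on {..<n} y" "y ` {..<n} \<subseteq> {..<3}"
    have "n \<le> 3" using strict_mono_on_card_le[OF xy(1,2)] by simp
    then show "det (mat n n (\<lambda>(i, j). K (x i) (y j) powr \<alpha>)) \<ge> 0"
      using assms xy by (intro tn_kernel_powr_det[OF K])
  qed
qed

lemma preserves_tn_sym_kernel_4:
  assumes "\<alpha> \<ge> 2"
  shows "preserves_tn_sym_kernel {..<4::nat} (\<lambda>x. x powr \<alpha>)"
  unfolding preserves_tn_sym_kernel_def
proof (intro allI impI)
  fix K assume K: "sym_kernel_on {..<4::nat} K" "tn_kernel_on {..<4::nat} K"
  show "tn_kernel_on {..<4} (\<lambda>x y. K x y powr \<alpha>)"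
    unfolding tn_kernel_on_def
  proof (intro allI impI)
    fix n and x y :: "nat \<Rightarrow> nat"
    assume xy: "strict_mono_on {..<n} x" "x ` {..<n} \<subseteq> {..<4}"
      "strict_mono_on {..<n} y" "y ` {..<n} \<subseteq> {..<4}"
    have "n \<le> 4" using strict_mono_on_card_le[OF xy(1,2)] by simp
    then consider "n \<le> 3" | "n = 4" by linarith
    then show "det (mat n n (\<lambda>(i, j). K (x i) (y j) powr \<alpha>)) \<ge> 0"
    proof cases
      case 1
      then show ?thesis using assms xy by (intro tn_kernel_powr_det[OF K(2)]) auto
    next
      case 2
      have "psd 4 K"
        using K(1) tn_kernel_onD[OF K(2)]
        by (intro psd_if_principal_minors) (auto simp: sym_kernel_on_def)
      \<comment> \<open>The exponent bound of \<open>psd_powr\<close> in size 4 is exactly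
        2.\<close>
      then have "psd 4 (\<lambda>i j. K i j powr \<alpha>)"
        using assms tn_kernel_on_nonneg[OF K(2)] by (intro psd_powr) auto
      then have "det (mat 4 4 (\<lambda>(i, j). K i j powr \<alpha>)) \<ge> 0"
        by (rule psd_det_nonneg)
      moreover have "x i = i" "y i = i" if "i < 4" for i
        using strict_mono_on_lessThan_id[of 4 _ i] xy that unfolding 2 by simp_all
      then have "mat 4 4 (\<lambda>(i, j). K (x i) (y j) powr \<alpha>) = mat 4 4 (\<lambda>(i, j). K i j powr \<alpha>)"
        by (intro eq_matI) simp_all
      ultimately show ?thesis using 2 by simp
    qed
  qed
qed

lemma preserves_tn_sym_kernel_if_characterization:
  assumes "tn_characterization d F"
  shows "preserves_tn_sym_kernel {..<d} F"
proof -
  have powr: "preserves_tn_sym_kernel {..<d} F"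
    if "c > 0" "\<forall>x\<ge>0. F x = c * x powr \<alpha>" "preserves_tn_sym_kernel {..<d} (\<lambda>x. x powr \<alpha>)" for c \<alpha>
  proof -
    have "preserves_tn_sym_kernel {..<d} (\<lambda>x. c * x powr \<alpha>)"
      using that by (intro preserves_tn_sym_kernel_scale) auto
    then show ?thesis
      by (subst preserves_tn_sym_kernel_cong[of F "\<lambda>x. c * x powr \<alpha>"]) (use that in auto)
  qed
  consider "nonneg_constant F" | "d = 1" "case_a F" | "d = 2" "case_b F" | "d = 3" "case_c F"
    | "d = 4" "case_d F" | "case_e F"
    using assms unfolding tn_characterization_def by blast
  then show ?thesis
  proof cases
    case 4
    then obtain c \<alpha> where "c > 0" "\<alpha> \<ge> 1" "\<forall>x\<ge>0. F x = c * x powr \<alpha>"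
      by (auto simp: case_c_def)
    then show ?thesis using powr[of c \<alpha>] preserves_tn_sym_kernel_3[of \<alpha>] 4(1) by blast
  next
    case 5
    then obtain c \<alpha> where c: "c > 0" "\<forall>x\<ge>0. F x = c * x powr \<alpha>" and "\<alpha> \<in> {1} \<union> {2..}"
      unfolding case_d_def by blast
    then have "\<alpha> = 1 \<or> \<alpha> \<ge> 2" by auto
    then show ?thesis
    proof
      assume "\<alpha> = 1"
      then have "case_e F" using c by (auto simp: case_e_def)
      then show ?thesis by (rule preserves_tn_sym_kernel_linear)
    next
      assume "\<alpha> \<ge> 2"
      then show ?thesis using powr[OF c] preserves_tn_sym_kernel_4 5(1) by simp
    qed
  qed (use preserves_tn_sym_kernel_const preserves_tn_sym_kernel_1 preserves_tn_sym_kernel_2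
      preserves_tn_sym_kernel_linear in auto)
qed

section \<open>Continuity of multiplicatively mid-convex functions\<close>

text \<open>Iterated midpoint convexity shrinks the increments of \<open>g\<close> at \<open>0\<close> geometrically, and
  monotonicity fills in the points between the dyadic ones.\<close>

lemma mono_midconvex_isCont_0:
  fixes g :: "real \<Rightarrow> real"
  assumes mono: "\<And>s t. s \<le> t \<Longrightarrow> g s \<le> g t"
    and mid: "\<And>s t. g ((s + t) / 2) \<le> (g s + g t) / 2"
  shows "isCont g 0"
proof -
  have up: "g ((1 / 2) ^ n) - g 0 \<le> (g 1 - g 0) * (1 / 2) ^ n" for n
  proof (induction n)
    case (Suc n)
    have "g ((1 / 2) ^ Suc n) - g 0 \<le> (g ((1 / 2) ^ n) - g 0) / 2"
      using mid[of "(1 / 2) ^ n" 0] by (simp add: field_simps)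
    also have "\<dots> \<le> (g 1 - g 0) * (1 / 2) ^ Suc n" using Suc by simp
    finally show ?case .
  qed simp
  have close: "\<bar>g x - g 0\<bar> \<le> (g 1 - g 0) * (1 / 2) ^ n" if "\<bar>x\<bar> \<le> (1 / 2) ^ n" for x n
  proof -
    \<comment> \<open>Monotonicity reduces the claim to the two end points; midpoint convexity at 0
      then bounds the drop on the left by the rise on the right.\<close>
    have "g x \<le> g ((1 / 2) ^ n)" "g (- ((1 / 2) ^ n)) \<le> g x"
      using that by (auto intro!: mono)
    moreover have "g 0 \<le> (g (- ((1 / 2) ^ n)) + g ((1 / 2) ^ n)) / 2"
      using mid[of "- ((1 / 2) ^ n)" "(1 / 2) ^ n"] by simp
    ultimately show ?thesis using up[of n] by (auto simp: abs_le_iff)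
  qed
  show ?thesis
    unfolding continuous_at_eps_delta
  proof (intro allI impI)
    fix e :: real assume "e > 0"
    have "(\<lambda>n. (g 1 - g 0) * (1 / 2) ^ n) \<longlonglongrightarrow> (g 1 - g 0) * 0"
      by (intro tendsto_intros) simp
    then have "eventually (\<lambda>n. (g 1 - g 0) * (1 / 2) ^ n < e) sequentially"
      using \<open>e > 0\<close> by (intro order_tendstoD) simp_all
    then obtain n where n: "(g 1 - g 0) * (1 / 2) ^ n < e"
      by (auto simp: eventually_sequentially)
    have "dist (g x) (g 0) < e" if "dist x 0 < (1 / 2) ^ n" for x
      using close[of x n] n that by (simp add: dist_real_def)
    then show "\<exists>d>0. \<forall>x'. dist x' 0 < d \<longrightarrow> dist (g x') (g 0) < e"
      by (intro exI[of _ "(1 / 2) ^ n"]) simp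
  qed
qed

text \<open>Every y > 0 is the geometric mean of x and y^2 / x; monotonicity settles y = 0.\<close>

lemma case_b_vanish:
  assumes "case_b F" "x > 0" "F x = 0"
  shows "\<forall>y\<ge>0. F y = 0"
proof -
  have F: "F y \<ge> 0" if "y \<ge> 0" for y using assms(1) that by (simp add: case_b_def)
  have pos: "F y = 0" if "y > 0" for y
  proof -
    have "F y * F y \<le> F x * F (y * y / x)"
      by (rule case_b_minor[OF assms(1)]) (use assms(2) that in simp_all)
    then have "F y * F y \<le> 0" using assms(3) by simp
    then show ?thesis by (auto simp: mult_le_0_iff)
  qed
  have "F 0 \<le> F x" using assms mono_onD[of "{0..}" F 0 x] by (simp add: case_b_def)
  then have "F 0 = 0" using assms(3) F[of 0] by simp
  then show ?thesis using pos by (auto simp: less_le)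
qed

text \<open>In the coordinate s with x = p exp s, the logarithm of \<open>F\<close> is monotone and
  midpoint convex, and its continuity at s = 0 is that of \<open>F\<close> at p. Taking logarithms
  requires positive values, so functions with a positive zero are split off first.\<close>

lemma case_b_continuous:
  assumes "case_b F"
  shows "continuous_on {0<..} F"
proof (cases "\<exists>x>0. F x = 0")
  case True
  then have zero: "F y = 0" if "y > 0" for y using case_b_vanish[OF assms, of x for x] that by (meson less_imp_le)
  have "continuous_on {0<..} F \<longleftrightarrow> continuous_on {0<..} (\<lambda>_ :: real. 0 :: real)"
    by (rule continuous_on_cong) (auto simp: zero)
  then show ?thesis by simp
next
  case False
  have F: "F y > 0" if "y > 0" for y
    using False assms that by (auto simp: case_b_def less_le)
  have "isCont F p" if p: "p > 0" for p
  proof -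
    define g where "g s = ln (F (p * exp s))" for s
    have "g s \<le> g t" if "s \<le> t" for s t
      using mono_onD[of "{0..}" F "p * exp s" "p * exp t"] assms F p that
      by (simp add: g_def case_b_def)
    moreover have "g ((s + t) / 2) \<le> (g s + g t) / 2" for s t
    proof -
      have "F (p * exp ((s + t) / 2)) * F (p * exp ((s + t) / 2)) \<le> F (p * exp s) * F (p * exp t)"
      proof (rule case_b_minor[OF assms])
        have "exp ((s + t) / 2) * exp ((s + t) / 2) = exp s * exp t"
          by (simp flip: exp_add)
        then have "p * exp ((s + t) / 2) * (p * exp ((s + t) / 2)) = p * exp s * (p * exp t)"
          by (metis mult.assoc mult.left_commute)
        then show "p * exp ((s + t) / 2) * (p * exp ((s + t) / 2)) \<le> p * exp s * (p * exp t)"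
          by (rule eq_refl)
      qed (use p in simp_all)
      then have "ln (F (p * exp ((s + t) / 2)) * F (p * exp ((s + t) / 2))) \<le> ln (F (p * exp s) * F (p * exp t))"
        using F p by simp
      then show ?thesis using F[of "p * exp _"] p by (simp add: g_def ln_mult_pos)
    qed
    ultimately have "isCont g 0" by (rule mono_midconvex_isCont_0)
    then have "isCont g (ln (p / p))" using p by simp
    then have "isCont (\<lambda>x. exp (g (ln (x / p)))) p"
      using p by (intro continuous_intros continuous_at_compose[of p "\<lambda>x. ln (x / p)" g, unfolded comp_def]) auto
    moreover have ev: "eventually (\<lambda>x. exp (g (ln (x / p))) = F x) (nhds p)"
    proof -
      have "eventually (\<lambda>x. x \<in> {0<..}) (nhds p)"
        using p by (intro eventually_nhds_in_open) auto
      then show ?thesis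
        by eventually_elim (use p F in \<open>simp add: g_def\<close>)
    qed
    ultimately show ?thesis by (simp only: isCont_cong[OF ev])
  qed
  then show ?thesis by (simp add: continuous_at_imp_continuous_on)
qed

section \<open>Necessity\<close>

lemma preserves_tn_gram:
  fixes a b c :: "'a::linorder \<Rightarrow> real"
  assumes "preserves_tn_sym_kernel X F"
    and "\<And>i. i \<in> X \<Longrightarrow> a i \<ge> 0 \<and> b i \<ge> 0 \<and> c i \<ge> 0"
    and "\<And>i j. i \<in> X \<Longrightarrow> j \<in> X \<Longrightarrow> i < j \<Longrightarrow>
      a i * b j - b i * a j \<ge> 0 \<and> a i * c j - c i * a j \<ge> 0 \<and> b i * c j - c i * b j \<ge> 0"
    and "\<And>i j k. i \<in> X \<Longrightarrow> j \<in> X \<Longrightarrow> k \<in> X \<Longrightarrow> i < j \<Longrightarrow> j < k \<Longrightarrow>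
      a i * (b j * c k - c j * b k) - b i * (a j * c k - c j * a k)
        + c i * (a j * b k - b j * a k) \<ge> 0"
  shows "tn_kernel_on X (\<lambda>i j. F (a i * a j + b i * b j + c i * c j))"
proof -
  have "sym_kernel_on X (\<lambda>i j. a i * a j + b i * b j + c i * c j)"
    by (simp add: sym_kernel_on_def mult.commute)
  moreover have "tn_kernel_on X (\<lambda>i j. a i * a j + b i * b j + c i * c j)"
    by (rule tn_kernel_on_gram) (fact assms)+
  ultimately show ?thesis
    using assms(1) by (simp add: preserves_tn_sym_kernel_def)
qed

lemma preserves_tn_gram2:
  fixes a b :: "'a::linorder \<Rightarrow> real"
  assumes "preserves_tn_sym_kernel X F"
    and "\<And>i. i \<in> X \<Longrightarrow> a i \<ge> 0 \<and> b i \<ge> 0"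
    and "\<And>i j. i \<in> X \<Longrightarrow> j \<in> X \<Longrightarrow> i < j \<Longrightarrow> a i * b j - b i * a j \<ge> 0"
  shows "tn_kernel_on X (\<lambda>i j. F (a i * a j + b i * b j))"
  using preserves_tn_gram[of X F a b "\<lambda>_. 0"] assms by simp

lemma preserves_tn_gram1:
  fixes u :: "'a::linorder \<Rightarrow> real"
  assumes "preserves_tn_sym_kernel X F" "\<And>i. i \<in> X \<Longrightarrow> u i \<ge> 0"
  shows "tn_kernel_on X (\<lambda>i j. F (u i * u j))"
  using preserves_tn_gram2[of X F u "\<lambda>_. 0"] assms by simp

lemma case_a_if_preserves:
  assumes "preserves_tn_sym_kernel {..<1::nat} F"
  shows "case_a F"
  unfolding case_a_def
proof (intro allI impI)
  fix x :: real assume "x \<ge> 0"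
  have "tn_kernel_on {..<1::nat} (\<lambda>i j. F (sqrt x * sqrt x))"
    by (rule preserves_tn_gram1[OF assms]) (use \<open>x \<ge> 0\<close> in simp)
  then show "F x \<ge> 0"
    using tn_kernel_on_nonneg[of "{..<1::nat}" "\<lambda>_ _. F x" 0 0] \<open>x \<ge> 0\<close> by simp
qed

lemma case_b_if_preserves:
  assumes "preserves_tn_sym_kernel {..<2::nat} F"
  shows "case_b F"
proof -
  have "preserves_tn_sym_kernel {..<1::nat} F"
    using assms by (rule preserves_tn_sym_kernel_subset) auto
  then have nonneg: "F x \<ge> 0" if "x \<ge> 0" for x
    using case_a_if_preserves that by (simp add: case_a_def)
  have "F x \<le> F y" if xy: "0 \<le> x" "x \<le> y" for x y
  proof -
    \<comment> \<open>The points (sqrt (y - x), sqrt x) and (0, sqrt x), whose Gram matrix has the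
      rows y, x and x, x.\<close>
    let ?a = "\<lambda>i::nat. if i = 0 then sqrt (y - x) else 0" and ?b = "\<lambda>i::nat. sqrt x"
    have "tn_kernel_on {..<2} (\<lambda>i j. F (?a i * ?a j + ?b i * ?b j))"
      by (rule preserves_tn_gram2[OF assms]) (use xy in auto)
    from tn_kernel_on_minor2[OF this, of 0 1 0 1] have "F x * F x \<le> F y * F x"
      using xy by simp
    then show ?thesis
      using nonneg[of x] nonneg[of y] xy by (cases "F x = 0") auto
  qed
  moreover have "(F (sqrt (x * y)))\<^sup>2 \<le> F x * F y" if xy: "0 \<le> x" "0 \<le> y" for x y
  proof -
    \<comment> \<open>Rank one, with diagonal x, y and the geometric mean off the diagonal.\<close>
    let ?u = "\<lambda>i::nat. if i = 0 then sqrt x else sqrt y"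
    have "tn_kernel_on {..<2} (\<lambda>i j. F (?u i * ?u j))"
      by (rule preserves_tn_gram1[OF assms]) (use xy in auto)
    from tn_kernel_on_minor2[OF this, of 0 1 0 1] show ?thesis
      using xy by (simp add: real_sqrt_mult power2_eq_square mult.commute)
  qed
  ultimately show ?thesis
    using nonneg by (auto simp: case_b_def mult_mid_convex_def intro!: mono_onI)
qed

section \<open>Power laws and necessity in size three\<close>

lemma mono_additive_imp_linear:
  fixes h :: "real \<Rightarrow> real"
  assumes mono: "\<And>s t. s \<le> t \<Longrightarrow> h s \<le> h t" and add: "\<And>s t. h (s + t) = h s + h t"
  shows "h s = s * h 1"
proof -
  have h0: "h 0 = 0" using add[of 0 0] by simp
  have minus: "h (- t) = - h t" for t using add[of t "- t"] h0 by simp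
  have nat: "h (real n * t) = real n * h t" for n t
    by (induction n) (simp_all add: h0 add distrib_right)
  have int: "h (of_int m) = of_int m * h 1" for m
    by (cases m rule: int_cases2) (use nat[of _ 1] in \<open>simp_all add: minus\<close>)
  \<comment> \<open>Between consecutive integers both \<open>h\<close> and the linear candidate are
    squeezed between the same two multiples of \<open>h 1\<close>.\<close>
  have close: "\<bar>h t - t * h 1\<bar> \<le> h 1" for t
  proof -
    have "h (of_int \<lfloor>t\<rfloor>) \<le> h t" "h t \<le> h (of_int (\<lfloor>t\<rfloor> + 1))"
      by (rule mono, linarith)+
    then have 1: "of_int \<lfloor>t\<rfloor> * h 1 \<le> h t" "h t \<le> (of_int \<lfloor>t\<rfloor> + 1) * h 1"
      unfolding int by simp_all
    have "h 1 \<ge> 0" using mono[of 0 1] h0 by simp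
    then have "of_int \<lfloor>t\<rfloor> * h 1 \<le> t * h 1" "t * h 1 \<le> (of_int \<lfloor>t\<rfloor> + 1) * h 1"
      by (intro mult_right_mono; linarith)+
    then show ?thesis using 1 by (simp add: distrib_right abs_le_iff)
  qed
  \<comment> \<open>Passing from s to n s multiplies the deviation by n, while the bound stays the
    same.\<close>
  have le: "real n * \<bar>h s - s * h 1\<bar> \<le> h 1" for n
  proof -
    have "h (real n * s) - real n * s * h 1 = real n * (h s - s * h 1)"
      unfolding nat by (simp add: algebra_simps)
    then show ?thesis using close[of "real n * s"] by (simp add: abs_mult)
  qed
  show ?thesis
  proof (rule ccontr)
    assume "h s \<noteq> s * h 1"
    then obtain n where "h 1 < real n * \<bar>h s - s * h 1\<bar>"
      using ex_less_of_nat_mult[of "\<bar>h s - s * h 1\<bar>" "h 1"] by auto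
    then show False using le[of n] by simp
  qed
qed

text \<open>Logarithms on both sides turn the multiplicative Cauchy equation into the additive one;
  the exponent is the slope \<open>h 1\<close>.\<close>

lemma mono_mult_imp_powr:
  fixes G :: "real \<Rightarrow> real"
  assumes pos: "\<And>x. x > 0 \<Longrightarrow> G x > 0" and mono: "\<And>x y. 0 < x \<Longrightarrow> x \<le> y \<Longrightarrow> G x \<le> G y"
    and mult: "\<And>x y. x > 0 \<Longrightarrow> y > 0 \<Longrightarrow> G (x * y) = G x * G y"
  obtains \<alpha> where "\<alpha> \<ge> 0" "\<And>x. x > 0 \<Longrightarrow> G x = x powr \<alpha>"
proof
  define h where "h s = ln (G (exp s))" for s
  have h: "h s = s * h 1" for s
  proof (rule mono_additive_imp_linear)
    show "h s \<le> h t" if "s \<le> t" for s t using that pos mono by (simp add: h_def)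
    show "h (s + t) = h s + h t" for s t
      using pos[of "exp s"] pos[of "exp t"] by (simp add: h_def exp_add mult ln_mult_pos)
  qed
  have "G 1 = 1" using mult[of 1 1] pos[of 1] by simp
  then have "ln 1 \<le> ln (G (exp 1))" using mono[of 1 "exp 1"] by simp
  then show "h 1 \<ge> 0" by (simp add: h_def)
  show "G x = x powr h 1" if "x > 0" for x
  proof -
    have "G x = exp (h (ln x))" using that pos by (simp add: h_def)
    also have "\<dots> = exp (ln x * h 1)" by (subst h) simp
    finally show ?thesis using that by (simp add: powr_def mult.commute)
  qed
qed

lemma power_law_if_preserves:
  assumes "preserves_tn_sym_kernel {..<3::nat} F" and pos: "\<And>x. x > 0 \<Longrightarrow> F x > 0"
  obtains \<alpha> where "\<alpha> \<ge> 0" "\<And>x. x > 0 \<Longrightarrow> F x = F 1 * x powr \<alpha>"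
proof -
  have "preserves_tn_sym_kernel {..<2::nat} F"
    using assms(1) by (rule preserves_tn_sym_kernel_subset) auto
  then have b: "case_b F" by (rule case_b_if_preserves)
  have minors: "F (u0 * u2) * F (u1 * u1) \<le> F (u0 * u1) * F (u1 * u2)"
    "F (u0 * u2) * F (u1 * u0) \<le> F (u0 * u0) * F (u1 * u2)"
    if "u0 > 0" "u1 > 0" "u2 > 0" for u0 u1 u2
  proof -
    let ?u = "\<lambda>i::nat. if i = 0 then u0 else if i = 1 then u1 else u2"
    have "tn_kernel_on {..<3} (\<lambda>i j. F (?u i * ?u j))"
      by (rule preserves_tn_gram1[OF assms(1)]) (use that in auto)
    from tn_kernel_on_minor2[OF this, of 0 1 1 2] tn_kernel_on_minor2[OF this, of 0 1 0 2]
    show "F (u0 * u2) * F (u1 * u1) \<le> F (u0 * u1) * F (u1 * u2)"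
      "F (u0 * u2) * F (u1 * u0) \<le> F (u0 * u0) * F (u1 * u2)"
      by simp_all
  qed
  \<comment> \<open>The points x, 1, y give one inequality and the points 1, y, x the other; points
    on a line may come in any order.\<close>
  have swap: "F x * F y = F 1 * F (x * y)" if "x > 0" "y > 0" for x y
    using minors(1)[of x 1 y] minors(2)[of 1 y x] that by (simp add: mult.commute)
  have F1: "F 1 > 0" using pos by simp
  obtain \<alpha> where \<alpha>: "\<alpha> \<ge> 0" "\<And>x. x > 0 \<Longrightarrow> F x / F 1 = x powr \<alpha>"
  proof (rule mono_mult_imp_powr[of "\<lambda>x. F x / F 1"])
    show "F x / F 1 > 0" if "x > 0" for x using that pos F1 by simp
    show "F x / F 1 \<le> F y / F 1" if "0 < x" "x \<le> y" for x y
      using that F1 b mono_onD[of "{0..}" F x y] by (simp add: case_b_def divide_right_mono)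
    show "F (x * y) / F 1 = F x / F 1 * (F y / F 1)" if "x > 0" "y > 0" for x y
      using swap[OF that] F1 by (simp add: field_simps)
  qed blast
  have "F x = F 1 * x powr \<alpha>" if "x > 0" for x
    using \<alpha>(2)[OF that] F1 by (simp add: field_simps)
  with \<alpha>(1) show ?thesis by (rule that)
qed

lemma case_c_if_preserves:
  assumes "preserves_tn_sym_kernel {..<3::nat} F"
  shows "nonneg_constant F \<or> case_c F"
proof (cases "\<exists>x>0. F x = 0")
  case True
  have "preserves_tn_sym_kernel {..<2::nat} F"
    using assms by (rule preserves_tn_sym_kernel_subset) auto
  then have "case_b F" by (rule case_b_if_preserves)
  then show ?thesis
    using True case_b_vanish unfolding nonneg_constant_def by blast
next
  case False
  have "preserves_tn_sym_kernel {..<2::nat} F"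
    using assms by (rule preserves_tn_sym_kernel_subset) auto
  then have b: "case_b F" by (rule case_b_if_preserves)
  have pos: "F x > 0" if "x > 0" for x
    using False b that by (auto simp: case_b_def less_le)
  obtain \<alpha> where \<alpha>: "\<alpha> \<ge> 0" "\<And>x. x > 0 \<Longrightarrow> F x = F 1 * x powr \<alpha>"
    using power_law_if_preserves[OF assms pos] by blast
  have F1: "F 1 > 0" by (simp add: pos)
  have F0: "F 0 \<ge> 0" using b by (simp add: case_b_def)
  have F0_le: "F 0 \<le> F x" if "x > 0" for x
    using b mono_onD[of "{0..}" F 0 x] that by (simp add: case_b_def)
  \<comment> \<open>The Gram matrix of these three points has the rows 1, 1, 0 and 1, 2, 1 and 0, 1,
    1.\<close>
  let ?a = "\<lambda>i::nat. if i = 2 then 0 else 1" and ?b = "\<lambda>i::nat. if i = 0 then 0 else 1"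
  have "tn_kernel_on {..<3} (\<lambda>i j. F (?a i * ?a j + ?b i * ?b j))"
    by (rule preserves_tn_gram2[OF assms]) auto
  from tn_kernel_onD[OF this, of 3 "\<lambda>i. i" "\<lambda>i. i"]
  have det: "F 1 * (F 2 * F 1 - F 1 * F 1) - F 1 * (F 1 * F 1 - F 1 * F 0) + F 0 * (F 1 * F 1 - F 2 * F 0) \<ge> 0"
    by (simp add: det_mat_3 strict_mono_on_def)
  show ?thesis
  proof (cases "\<alpha> = 0")
    case True
    then have const: "F x = F 1" if "x > 0" for x using \<alpha>(2)[OF that] that by simp
    \<comment> \<open>For \<alpha> = 0 the determinant is a negative multiple of a square, which
      excludes a jump at 0.\<close>
    have "F 1 * (F 2 * F 1 - F 1 * F 1) - F 1 * (F 1 * F 1 - F 1 * F 0) + F 0 * (F 1 * F 1 - F 2 * F 0)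
        = - (F 1 * (F 1 - F 0)\<^sup>2)"
      using const[of 2] by (simp add: power2_eq_square algebra_simps)
    then have "F 1 * (F 1 - F 0)\<^sup>2 \<le> 0" using det by linarith
    then have "F 0 = F 1" using F1 by (simp add: mult_le_0_iff)
    then have "F x = F 1" if "x \<ge> 0" for x using const[of x] that by (cases "x = 0") auto
    then show ?thesis using less_imp_le[OF F1] unfolding nonneg_constant_def by blast
  next
    case False
    have "F 0 = 0"
    proof (rule ccontr)
      assume "F 0 \<noteq> 0"
      then have "F 0 > 0" using F0 by simp
      \<comment> \<open>Chosen so that \<open>F x\<close> is half of \<open>F 0\<close>, against
        monotonicity.\<close>
      define x where "x = (F 0 / (2 * F 1)) powr (1 / \<alpha>)"
      have "x > 0" using \<open>F 0 > 0\<close> F1 by (simp add: x_def)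
      then have "F x = F 1 * x powr \<alpha>" by (rule \<alpha>(2))
      also have "\<dots> = F 0 / 2" using False \<open>F 0 > 0\<close> F1 by (simp add: x_def powr_powr)
      finally show False using F0_le[OF \<open>x > 0\<close>] \<open>F 0 > 0\<close> by simp
    qed
    then have "F 1 * F 1 * (F 2 - 2 * F 1) \<ge> 0"
      using det by (simp add: algebra_simps)
    moreover have "F 1 * F 1 > 0" using F1 by simp
    ultimately have "2 * F 1 \<le> F 2" using zero_le_mult_iff[of "F 1 * F 1"] by auto
    then have "2 powr 1 \<le> 2 powr \<alpha>" using \<alpha>(2)[of 2] F1 by simp
    then have "\<alpha> \<ge> 1" by (subst (asm) powr_le_cancel_iff) auto
    moreover have "F x = F 1 * x powr \<alpha>" if "x \<ge> 0" for x
      using \<alpha>(2)[of x] that \<open>F 0 = 0\<close> by (cases "x = 0") auto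
    ultimately show ?thesis using F1 unfolding case_c_def by blast
  qed
qed

section \<open>Excluded exponents in sizes four and five\<close>

lemma not_preserves_powr_4:
  assumes "1 < \<alpha>" "\<alpha> < 2"
  shows "\<not> preserves_tn_sym_kernel {..<4::nat} (\<lambda>x. x powr \<alpha>)"
proof
  assume pres: "preserves_tn_sym_kernel {..<4::nat} (\<lambda>x. x powr \<alpha>)"
  \<comment> \<open>From the full determinant at the points (1, 0), (1, sqrt t), (1, 1 / sqrt t),
    (0, 1). For small t the right-hand side tends to 0 because \<alpha> < 2, while the left-hand
    side is positive because \<alpha> > 1.\<close>
  have bound: "(2 powr \<alpha> - 2)\<^sup>2 \<le> 9 * t powr (2 - \<alpha>)" if t: "0 < t" "t < 1" for t
  proof -
    let ?a = "\<lambda>i::nat. if i = 3 then 0 else 1"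
    let ?b = "\<lambda>i::nat. if i = 0 then 0 else if i = 1 then sqrt t else if i = 2 then 1 / sqrt t else 1"
    have st: "sqrt t > 0" "sqrt t \<le> 1 / sqrt t" "sqrt t * sqrt t = t"
      using t by (simp_all add: field_simps)
    have "tn_kernel_on {..<4} (\<lambda>i j. (?a i * ?a j + ?b i * ?b j) powr \<alpha>)"
      by (rule preserves_tn_gram2[OF pres]) (use t st in auto)
    note det = tn_kernel_onD[OF this, of 4 "\<lambda>i. i" "\<lambda>i. i"]
    \<comment> \<open>All powers in the determinant are expressed through \<open>A\<close>,
      \<open>s\<close> and \<open>2 powr \<alpha>\<close>.\<close>
    define A s where "A = (1 + t) powr \<alpha>" and "s = sqrt t powr \<alpha>"
    have s: "s > 0" "s * s = t powr \<alpha>"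
      using t by (simp_all add: s_def powr_mult[symmetric])
    have "(1 + 1 / t) powr \<alpha> = ((1 + t) / t) powr \<alpha>" using t by (simp add: field_simps)
    then have C: "(1 + 1 / t) powr \<alpha> = A / (s * s)"
      using t by (simp add: A_def s(2) powr_divide)
    have inv: "(1 / sqrt t) powr \<alpha> = 1 / s" using t by (simp add: s_def powr_divide)
    have "0 \<le> (A * (A / (s * s) - (1 / s) * (1 / s)) - 2 powr \<alpha> * (2 powr \<alpha> - 1) + s * (2 powr \<alpha> * (1 / s) - A / (s * s) * s))
      - ((A / (s * s) - (1 / s) * (1 / s)) - 2 powr \<alpha> + s * (1 / s))
      + ((2 powr \<alpha> - (1 / s) * s) - A + s * s)"
      using det t st C inv s(1)
      by (simp add: det_mat_4 strict_mono_on_def flip: A_def s_def)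
    also have "\<dots> = ((A - 1 - s * s)\<^sup>2 / (s * s) - (2 powr \<alpha> - 2)\<^sup>2)"
      using s(1) by (simp add: field_simps power2_eq_square)
    finally have "(2 powr \<alpha> - 2)\<^sup>2 \<le> (A - 1 - t powr \<alpha>)\<^sup>2 / t powr \<alpha>"
      using s by simp
    also have "\<dots> \<le> (3 * t)\<^sup>2 / t powr \<alpha>"
    proof (intro divide_right_mono power_mono)
      have "A \<ge> 1 + \<alpha> * t" using powr_ge_tangent[of "1 + t" \<alpha>] t assms by (simp add: A_def)
      moreover have "\<alpha> * t \<ge> t" using t assms by simp
      moreover have "t powr \<alpha> \<le> t" using powr_mono'[of 1 \<alpha> t] t assms by simp
      ultimately show "0 \<le> A - 1 - t powr \<alpha>" by linarith
      have "A \<le> (1 + t) powr 2" unfolding A_def using t assms by (intro powr_mono) auto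
      also have "\<dots> = 1 + 2 * t + t * t" using t by (simp add: power2_eq_square algebra_simps)
      also have "\<dots> \<le> 1 + 3 * t" using t by (simp add: mult_left_le)
      finally show "A - 1 - t powr \<alpha> \<le> 3 * t" using powr_ge_zero[of t \<alpha>] by linarith
    qed simp
    also have "\<dots> = 9 * (t powr 2 / t powr \<alpha>)" using t by (simp add: power_mult_distrib)
    also have "\<dots> = 9 * t powr (2 - \<alpha>)" by (simp add: powr_diff)
    finally show ?thesis .
  qed
  define r where "r = (2 powr \<alpha> - 2)\<^sup>2"
  have "2 powr 1 < 2 powr \<alpha>" "2 powr \<alpha> < 2 powr 2"
    using assms by (intro powr_less_mono; simp)+
  then have B: "0 < 2 powr \<alpha> - 2" "2 powr \<alpha> - 2 < (2::real)" by simp_all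
  then have r: "0 < r" "r < 4"
    using power_strict_mono[of "2 powr \<alpha> - 2" 2 2] by (simp_all add: r_def)
  \<comment> \<open>With this t the bound reads r \<le> r / 2; since r < 4, also t < 1.\<close>
  define t where "t = (r / 18) powr (1 / (2 - \<alpha>))"
  have "t > 0" using r by (simp add: t_def)
  moreover have "t < 1" unfolding t_def
    using r assms powr_less_mono2[of "1 / (2 - \<alpha>)" "r / 18" 1] by simp
  ultimately have "r \<le> 9 * t powr (2 - \<alpha>)" unfolding r_def by (rule bound)
  also have "\<dots> = r / 2" using r assms by (simp add: t_def powr_powr)
  finally show False using r by simp
qed

lemma case_d_if_preserves:
  assumes "preserves_tn_sym_kernel {..<4::nat} F"
  shows "nonneg_constant F \<or> case_d F"
proof -
  have "preserves_tn_sym_kernel {..<3::nat} F"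
    using assms by (rule preserves_tn_sym_kernel_subset) auto
  then consider "nonneg_constant F" | "case_c F" using case_c_if_preserves by blast
  then show ?thesis
  proof cases
    case 2
    then obtain c \<alpha> where c: "c > 0" "\<alpha> \<ge> 1" "\<And>x. x \<ge> 0 \<Longrightarrow> F x = c * x powr \<alpha>"
      by (auto simp: case_c_def)
    have "preserves_tn_sym_kernel {..<4::nat} (\<lambda>x. 1 / c * F x)"
      using assms c by (intro preserves_tn_sym_kernel_scale) auto
    then have "preserves_tn_sym_kernel {..<4::nat} (\<lambda>x. x powr \<alpha>)"
      by (subst (asm) preserves_tn_sym_kernel_cong[of _ "\<lambda>x. x powr \<alpha>"]) (use c in auto)
    then have "\<not> (1 < \<alpha> \<and> \<alpha> < 2)" using not_preserves_powr_4 by blast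
    then have "\<alpha> \<in> {1} \<union> {2..}" using c(2) by auto
    then show ?thesis using c unfolding case_d_def by blast
  qed simp
qed

text \<open>Rows 1 to 4 and columns 0, 1, 2, 4 of the Gram kernel of (p, 1, 0), (2q, 1, 0), (q, 1,
  \<sigma>), (0, 1, 2\<sigma>), (0, 1, 3\<sigma>) with pq = e and q^2 = e^2 z. In these parameters p
  -> infinity becomes z -> 0, where all entries stay finite, and \<open>2 * e * z \<le> 1\<close>
  says that 2q \<le> p.\<close>

lemma minor5_powr_nonneg:
  fixes \<alpha> \<sigma> e z :: real
  assumes pres: "preserves_tn_sym_kernel {..<5::nat} (\<lambda>x. x powr \<alpha>)"
    and pos: "\<sigma> > 0" "e > 0" "z > 0" "2 * e * z \<le> 1"
  defines "w \<equiv> \<sigma>\<^sup>2"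
  shows "det (mat 4 4 (\<lambda>(i, j). ([[1 + 2 * e, 1 + 4 * e\<^sup>2 * z, 1 + 2 * e\<^sup>2 * z, 1],
      [1 + e, 1 + 2 * e\<^sup>2 * z, 1 + w + e\<^sup>2 * z, 1 + 3 * w],
      [1, 1, 1 + 2 * w, 1 + 6 * w],
      [1, 1, 1 + 3 * w, 1 + 9 * w]] ! i ! j) powr \<alpha>)) \<ge> 0"
    (is "det (mat 4 4 (\<lambda>(i, j). (?M ! i ! j) powr \<alpha>)) \<ge> 0")
proof -
  define p q where "p = 1 / sqrt z" and "q = e * sqrt z"
  let ?a = "\<lambda>i. [p, 2 * q, q, 0, 0] ! i"
  let ?b = "\<lambda>_ :: nat. 1 :: real"
  let ?c = "\<lambda>i. [0, 0, \<sigma>, 2 * \<sigma>, 3 * \<sigma>] ! i"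
  have five: "i \<in> {..<5} \<longleftrightarrow> i = 0 \<or> i = 1 \<or> i = 2 \<or> i = 3 \<or> i = 4" for i :: nat
    by auto
  have "p > 0" "q > 0" using pos by (simp_all add: p_def q_def)
  have pq: "p * q = e" "q * q = e\<^sup>2 * z"
    using pos by (simp_all add: p_def q_def power2_eq_square)
  have "2 * q * sqrt z = 2 * e * z" using pos(3) by (simp add: q_def mult.assoc)
  then have le2: "2 * q \<le> p"
    using pos(3,4) unfolding p_def by (simp only: pos_le_divide_eq real_sqrt_gt_0_iff)
  then have le: "q \<le> p" using \<open>q > 0\<close> by linarith
  have "tn_kernel_on {..<5} (\<lambda>i j. (?a i * ?a j + ?b i * ?b j + ?c i * ?c j) powr \<alpha>)"
  proof (rule preserves_tn_gram[OF pres])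
    show "?a i \<ge> 0 \<and> ?b i \<ge> 0 \<and> ?c i \<ge> 0" if "i \<in> {..<5}" for i
      using that pos \<open>p > 0\<close> \<open>q > 0\<close> unfolding five by (elim disjE) simp_all
    show "?a i * ?b j - ?b i * ?a j \<ge> 0 \<and> ?a i * ?c j - ?c i * ?a j \<ge> 0
        \<and> ?b i * ?c j - ?c i * ?b j \<ge> 0"
      if "i \<in> {..<5}" "j \<in> {..<5}" "i < j" for i j
      using that pos \<open>p > 0\<close> \<open>q > 0\<close> le le2 unfolding five by (elim disjE) simp_all
    show "?a i * (?b j * ?c k - ?c j * ?b k) - ?b i * (?a j * ?c k - ?c j * ?a k)
        + ?c i * (?a j * ?b k - ?b j * ?a k) \<ge> 0"
      if "i \<in> {..<5}" "j \<in> {..<5}" "k \<in> {..<5}" "i < j" "j < k" for i j k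
    proof -
      have "2 * q * \<sigma> \<le> p * \<sigma>"
        using le2 pos by (intro mult_right_mono) auto
      moreover have "q * \<sigma> > 0" using pos \<open>q > 0\<close> by simp
      moreover have "(i, j, k) \<in> {(0, 1, 2), (0, 1, 3), (0, 1, 4), (0, 2, 3), (0, 2, 4), (0, 3, 4),
          (1, 2, 3), (1, 2, 4), (1, 3, 4), (2, 3, 4)}"
        using that unfolding five by (elim disjE) simp_all
      ultimately show ?thesis
        by (elim insertE) (simp_all add: algebra_simps)
    qed
  qed
  note tn = this
  \<comment> \<open>Omits column 3; row 0 is omitted by \<open>Suc i\<close>.\<close>
  let ?y = "\<lambda>j::nat. if j = 3 then 4 else j"
  have *: "det (mat 4 4 (\<lambda>(i, j). (?a (Suc i) * ?a (?y j) + ?b (Suc i) * ?b (?y j)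
      + ?c (Suc i) * ?c (?y j)) powr \<alpha>)) \<ge> 0"
    by (rule tn_kernel_onD[OF tn]) (auto simp: strict_mono_on_def)
  have four: "i < 4 \<longleftrightarrow> i = 0 \<or> i = 1 \<or> i = 2 \<or> i = 3" for i :: nat
    by auto
  have "?a (Suc i) * ?a (?y j) + ?b (Suc i) * ?b (?y j) + ?c (Suc i) * ?c (?y j) = ?M ! i ! j"
    if "i < 4" "j < 4" for i j
    using that pq unfolding four
    by (elim disjE) (simp_all add: w_def power2_eq_square algebra_simps)
  then have "mat 4 4 (\<lambda>(i, j). (?a (Suc i) * ?a (?y j) + ?b (Suc i) * ?b (?y j)
      + ?c (Suc i) * ?c (?y j)) powr \<alpha>) = mat 4 4 (\<lambda>(i, j). (?M ! i ! j) powr \<alpha>)"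
    by (intro eq_matI) simp_all
  then show ?thesis using * by simp
qed

lemma not_preserves_powr_5:
  assumes "\<alpha> > 1"
  shows "\<not> preserves_tn_sym_kernel {..<5::nat} (\<lambda>x. x powr \<alpha>)"
proof
  assume pres: "preserves_tn_sym_kernel {..<5::nat} (\<lambda>x. x powr \<alpha>)"
  \<comment> \<open>At z = 0 column 1 of the minor consists of ones. Subtracting it from the other
    columns turns their powers into values of \<open>f\<close>; \<open>D\<close> and
    \<open>Q\<close> are the minors complementary to the entries \<open>f (2 * e)\<close> and
    \<open>f e\<close>, the only ones left in column 0.\<close>
  define f where "f t = (1 + t) powr \<alpha> - 1" for t :: real
  define Q where "Q w = f (2 * w) * f (9 * w) - f (3 * w) * f (6 * w)" for w
  define D where "D w = Q w - f w * f (9 * w) + f (3 * w) * f (3 * w)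
    + f w * f (6 * w) - f (3 * w) * f (2 * w)" for w
  have limit_z: "f e * Q w \<le> f (2 * e) * D w" if "w > 0" "e > 0" for w e
  proof -
    let ?M = "\<lambda>z. [[1 + 2 * e, 1 + 4 * e\<^sup>2 * z, 1 + 2 * e\<^sup>2 * z, 1],
      [1 + e, 1 + 2 * e\<^sup>2 * z, 1 + w + e\<^sup>2 * z, 1 + 3 * w],
      [1, 1, 1 + 2 * w, 1 + 6 * w],
      [1, 1, 1 + 3 * w, 1 + 9 * w]]"
    let ?d = "\<lambda>z. det (mat 4 4 (\<lambda>(i, j). (?M z ! i ! j) powr \<alpha>))"
    have "isCont ?d 0"
      unfolding det_mat_4 using that by (auto intro!: continuous_intros)
    then have "(?d \<longlongrightarrow> ?d 0) (at_right 0)"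
      by (simp add: isCont_def filterlim_at_split)
    moreover have "eventually (\<lambda>z. ?d z \<ge> 0) (at_right 0)"
    proof -
      have "eventually (\<lambda>z::real. z \<in> {0<..<1 / (2 * e)}) (at_right 0)"
        using that by (intro eventually_at_right_real) simp
      then show ?thesis
      proof eventually_elim
        case (elim z)
        then show ?case
          using minor5_powr_nonneg[OF pres, of "sqrt w" e z] that by (simp add: field_simps)
      qed
    qed
    ultimately have "?d 0 \<ge> 0" by (intro tendsto_lowerbound) auto
    also have "?d 0 = f (2 * e) * D w - f e * Q w"
      unfolding det_mat_4 by (simp add: D_def Q_def f_def algebra_simps)
    finally show ?thesis by simp
  qed
  \<comment> \<open>Divide by e and let e tend to 0: the slope of \<open>f\<close> at 0 is
    \<alpha>.\<close>
  have limit_e: "Q w \<le> 2 * D w" if "w > 0" for w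
  proof -
    have "((\<lambda>e. f (2 * e) / e * D w - f e / e * Q w) \<longlongrightarrow> 2 * \<alpha> * D w - \<alpha> * Q w) (at_right 0)"
      unfolding f_def by (intro tendsto_intros; real_asymp)
    moreover have "eventually (\<lambda>e. f (2 * e) / e * D w - f e / e * Q w \<ge> 0) (at_right 0)"
      using eventually_at_right_less[of 0]
    proof eventually_elim
      case (elim e)
      then have "(f (2 * e) * D w - f e * Q w) / e \<ge> 0" using limit_z[OF that elim] by simp
      then show ?case by (simp add: diff_divide_distrib)
    qed
    ultimately have "2 * \<alpha> * D w - \<alpha> * Q w \<ge> 0" by (intro tendsto_lowerbound) auto
    then have "\<alpha> * (2 * D w - Q w) \<ge> 0" by (simp add: algebra_simps)
    then show ?thesis using assms by (simp add: zero_le_mult_iff)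
  qed
  \<comment> \<open>The terms of order w^2 cancel in \<open>Q\<close> and in \<open>D\<close>, so
    the cubic coefficient decides the sign.\<close>
  have "((\<lambda>w. (2 * D w - Q w) / w ^ 3) \<longlongrightarrow> - (6 * (\<alpha> * (\<alpha> * (\<alpha> - 1))))) (at_right 0)"
    unfolding D_def Q_def f_def using assms by real_asymp
  moreover have "eventually (\<lambda>w. (2 * D w - Q w) / w ^ 3 \<ge> 0) (at_right 0)"
    using eventually_at_right_less[of 0]
    by eventually_elim (use limit_e in simp)
  ultimately have "- (6 * (\<alpha> * (\<alpha> * (\<alpha> - 1)))) \<ge> 0" by (rule tendsto_lowerbound) simp
  moreover have "\<alpha> * (\<alpha> * (\<alpha> - 1)) > 0" using assms by simp
  ultimately show False by simp
qed

lemma case_e_if_preserves: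
  assumes "preserves_tn_sym_kernel {..<5::nat} F"
  shows "nonneg_constant F \<or> case_e F"
proof -
  have "preserves_tn_sym_kernel {..<3::nat} F"
    using assms by (rule preserves_tn_sym_kernel_subset) auto
  then consider "nonneg_constant F" | "case_c F" using case_c_if_preserves by blast
  then show ?thesis
  proof cases
    case 2
    then obtain c \<alpha> where c: "c > 0" "\<alpha> \<ge> 1" "\<And>x. x \<ge> 0 \<Longrightarrow> F x = c * x powr \<alpha>"
      by (auto simp: case_c_def)
    have "preserves_tn_sym_kernel {..<5::nat} (\<lambda>x. 1 / c * F x)"
      using assms c by (intro preserves_tn_sym_kernel_scale) auto
    then have "preserves_tn_sym_kernel {..<5::nat} (\<lambda>x. x powr \<alpha>)"
      by (subst (asm) preserves_tn_sym_kernel_cong[of _ "\<lambda>x. x powr \<alpha>"]) (use c in auto)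
    then have "\<alpha> = 1" using not_preserves_powr_5 c(2) by force
    then show ?thesis using c unfolding case_e_def by auto
  qed simp
qed

lemma preserves_tn_sym_kernel_iff_characterization:
  assumes "d \<ge> 1"
  shows "preserves_tn_sym_kernel {..<d} F \<longleftrightarrow> tn_characterization d F"
proof
  assume pres: "preserves_tn_sym_kernel {..<d} F"
  consider "d = 1" | "d = 2" | "d = 3" | "d = 4" | "d \<ge> 5" using assms by linarith
  then show "tn_characterization d F"
  proof cases
    case 5
    then have "preserves_tn_sym_kernel {..<5::nat} F"
      by (intro preserves_tn_sym_kernel_subset[OF pres]) auto
    then show ?thesis using case_e_if_preserves 5 by (auto simp: tn_characterization_def)
  qed (use pres case_a_if_preserves case_b_if_preserves case_c_if_preserves case_d_if_preserves
      in \<open>auto simp: tn_characterization_def\<close>)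
qed (rule preserves_tn_sym_kernel_if_characterization)

theorem theorem3p6:
  fixes F :: "real \<Rightarrow> real" and d :: nat
  assumes "d \<ge> 1"
  shows "(preserves_tn_sym_mat d F \<longleftrightarrow> tn_characterization d F)
       \<and> (case_b F \<longrightarrow> continuous_on {0<..} F)
       \<and> (\<forall>X :: 'a::linorder set. finite X \<longrightarrow> card X = d \<longrightarrow>
            (preserves_tn_sym_kernel X F \<longleftrightarrow> tn_characterization d F))
       \<and> (\<forall>X :: 'a::linorder set. infinite X \<longrightarrow>
            (preserves_tn_sym_kernel X F \<longleftrightarrow> nonneg_constant F \<or> case_e F))"
proof (intro conjI allI impI)
  show "preserves_tn_sym_mat d F \<longleftrightarrow> tn_characterization d F"
    using preserves_tn_sym_kernel_iff_characterization[OF assms]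
    by (simp add: preserves_tn_sym_mat_iff_kernel)
next
  show "continuous_on {0<..} F" if "case_b F"
    using that by (rule case_b_continuous)
next
  fix X :: "'a set" assume "finite X" "card X = d"
  then show "preserves_tn_sym_kernel X F \<longleftrightarrow> tn_characterization d F"
    using preserves_tn_sym_kernel_iff_characterization[OF assms]
    by (simp only: preserves_tn_sym_kernel_finite[of X])
next
  fix X :: "'a set" assume "infinite X"
  \<comment> \<open>Five points already force a constant or a linear function, and these preserve
    total non-negativity on every ordered set.\<close>
  then obtain Y where Y: "Y \<subseteq> X" "finite Y" "card Y = 5"
    using infinite_arbitrarily_large by blast
  show "preserves_tn_sym_kernel X F \<longleftrightarrow> nonneg_constant F \<or> case_e F"
  proof
    assume "preserves_tn_sym_kernel X F"
    then have "preserves_tn_sym_kernel Y F"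
      using Y(1) by (rule preserves_tn_sym_kernel_subset)
    then have "preserves_tn_sym_kernel {..<5::nat} F"
      using preserves_tn_sym_kernel_finite[OF Y(2)] Y(3) by simp
    then show "nonneg_constant F \<or> case_e F" by (rule case_e_if_preserves)
  qed (auto intro: preserves_tn_sym_kernel_const preserves_tn_sym_kernel_linear)
qed

end
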